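(* Let the initial value problem $u'(t)=\mathcal{L}u(t)+\mathcal{N}(t,u(t))$, $u(t_0)=u_0$, satisfy Assumptions 1 and 2 (stated in the context). Consider for its numerical solution a MERK method (defined in the context) that is constructed from an explicit exponential Runge--Kutta method of global order $p$. Assume further that the "fast" ODEs for $y_{n,i}$ ($i=2,\ldots,s$) and for $y_n$ associated with the MERK method are integrated with micro time step $h=H/m$ by ODE solvers that have global order of convergence $q$ and $r$, respectively, where $m$ is the number of fast steps per slow step. Then the MERK method is convergent, and its approximations $\hat{u}_n$ satisfy the error bound $$\|\hat{u}_n-u(t_n)\|\le C_1H^p+C_2Hh^q+C_3h^r$$ on compact time intervals $t_0\le t_n=t_0+nH\le T$. Here the constant $C_1$ depends on $T-t_0$, but is independent of $n$ and $H$; and the constants $C_2$ and $C_3$ also depend on the error constants of the chosen ODE solvers.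
   Context: Problem: $u'(t)=\mathcal{L}u(t)+\mathcal{N}(t,u(t))$, $u(t_0)=u_0$, $t_0<t\le T$, on a Banach space $X$; $H>0$ is the macro time step, $t_n=t_0+nH$. Assumption 1: $\mathcal{L}$ is the infinitesimal generator of an analytic semigroup $e^{t\mathcal{L}}$ on $X$; this gives $\|e^{t\mathcal{L}}\|_{X\leftarrow X}\le C$ for $t\ge0$, and consequently $\varphi_k(H\mathcal{L})$, $a_{ij}(H\mathcal{L})$, $b_i(H\mathcal{L})$ are bounded operators. Assumption 2: the solution $u:[t_0,T]\to X$ is sufficiently smooth with derivatives in $X$, and $\mathcal{N}:[t_0,T]\times X\to X$ is sufficiently Fréchet differentiable in a strip along the exact solution. All derivatives that occur are assumed to be uniformly bounded. Functions: $\varphi_k(z)=\int_0^1e^{(1-\theta)z}\frac{\theta^{k-1}}{(k-1)!}d\theta$ for $k\ge1$, applied to multiples of $\mathcal{L}$ via the semigroup. Base method: an explicit $s$-stage exponential Runge--Kutta (ExpRK) method with nodes $c_1=0,c_2,\ldots,c_s$ ($c_i\ne0$ for $i\ge2$), whose coefficients have the form $a_{ij}(H\mathcal{L})=\sum_{k=1}^{\ell_{ij}}\alpha_{ij}^{(k)}\varphi_k(c_iH\mathcal{L})$ for $2\le j<i\le s$ and $b_i(H\mathcal{L})=\sum_{k=1}^{m_i}\beta_i^{(k)}\varphi_k(H\mathcal{L})$ for $2\le i\le s$, together with $a_{i1}(H\mathcal{L})=c_i\varphi_1(c_iH\mathcal{L})-\sum_{j=2}^{i-1}a_{ij}(H\mathcal{L})$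 and $b_1(H\mathcal{L})=\varphi_1(H\mathcal{L})-\sum_{i=2}^sb_i(H\mathcal{L})$. From $u_n$ it computes $$U_{n,i}=e^{c_iH\mathcal{L}}u_n+H\sum_{j=1}^{i-1}a_{ij}(H\mathcal{L})\mathcal{N}(t_n+c_jH,U_{n,j}),\ i=1,\ldots,s,\qquad u_{n+1}=e^{H\mathcal{L}}u_n+H\sum_{i=1}^sb_i(H\mathcal{L})\mathcal{N}(t_n+c_iH,U_{n,i}).$$ Its local error is $\breve{e}_{n+1}=\breve{u}_{n+1}-u(t_{n+1})$, where $\breve{u}_{n+1}$ is the result of one such step started from the exact value $u_n=u(t_n)$. That the method has global order $p$ is understood to include $\|\breve{e}_{n+1}\|=\mathcal{O}(H^{p+1})$, uniformly for $t_0\le t_n\le t_{n+1}\le T$. MERK method: set $\hat{u}_0=u_0$. Given $\hat{u}_n$, set $\widehat{U}_{n,1}=\hat{u}_n$. For $i=2,\ldots,s$ successively, let $y_{n,i}$ be the exact solution on $[0,c_iH]$ (given by the variation-of-constants formula) of $$y_{n,i}'(\tau)=\mathcal{L}y_{n,i}(\tau)+\hat{p}_{n,i}(\tau),\quad y_{n,i}(0)=\hat{u}_n,\qquad \hat{p}_{n,i}(\tau)=\mathcal{N}(t_n,\hat{u}_n)+\sum_{j=2}^{i-1}\Big(\sum_{k=1}^{\ell_{ij}}\frac{\alpha_{ij}^{(k)}}{c_i^kH^{k-1}(k-1)!}\tau^{k-1}\Big)\widehat{D}_{n,j},$$ and let $\widehat{U}_{n,i}\approx y_{n,i}(c_iH)$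 be computed by an ODE solver with micro step $h$, where $\widehat{D}_{n,i}=\mathcal{N}(t_n+c_iH,\widehat{U}_{n,i})-\mathcal{N}(t_n,\hat{u}_n)$. Then let $y_n$ be the exact solution on $[0,H]$ of $$y_n'(\tau)=\mathcal{L}y_n(\tau)+\hat{q}_n(\tau),\quad y_n(0)=\hat{u}_n,\qquad \hat{q}_n(\tau)=\mathcal{N}(t_n,\hat{u}_n)+\sum_{i=2}^{s}\Big(\sum_{k=1}^{m_i}\frac{\beta_i^{(k)}}{H^{k-1}(k-1)!}\tau^{k-1}\Big)\widehat{D}_{n,i},$$ and let $\hat{u}_{n+1}\approx y_n(H)$ be computed by an ODE solver with micro step $h$. Order of the fast solvers: since they are employed on the intervals $[0,c_iH]$ and $[0,H]$ only, global order $q$ (respectively $r$) is understood to mean that the solver errors satisfy $\|\widehat{U}_{n,i}-y_{n,i}(c_iH)\|\le c_2Hh^q$ for $i=2,\ldots,s$ and $\|\hat{u}_{n+1}-y_n(H)\|\le c_3Hh^r$, with error constants $c_2,c_3$ independent of $n$, $H$ and $h$.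
   Formalization: The error bound is stated for all sufficiently small macro steps H ≤ H0 (H0 independent of n and m, but depending on the solver error constants), since N is controlled only in a strip; nodes are taken with 0 < c_i ≤ 1 so that the method is well defined on [t0,T]. *)

theory Defs
  imports "HOL-Analysis.Analysis"
begin

section \<open>Analytic semigroups\<close>

definition c0_semigroup :: "(real \<Rightarrow> 'a::banach \<Rightarrow>\<^sub>L 'a) \<Rightarrow> bool" where
  "c0_semigroup S \<longleftrightarrow>
     S 0 = id_blinfun \<and>
     (\<forall>s\<ge>0. \<forall>t\<ge>0. S (s + t) = S s o\<^sub>L S t) \<and>
     (\<forall>x. ((\<lambda>t. blinfun_apply (S t) x) \<longlongrightarrow> x) (at_right 0))"

text \<open>
  The Banach space is a real one, so holomorphy is expressed in its complexification: the pair
  \<open>(x, y)\<close> stands for \<open>x + i y\<close>, multiplication by \<open>i\<close> is \<open>cunit\<close>, and an operator is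
  complex-linear iff it commutes with \<open>cunit\<close>. The product norm is equivalent to the usual norms of
  the complexification. For a complex Banach space and a complex-linear semigroup the resulting
  notion is the usual one, because the complexification of the underlying real space is then the
  direct sum of the space and its conjugate, and sectors are symmetric about the real axis.
\<close>

lift_definition cunit :: "('a::real_normed_vector \<times> 'a) \<Rightarrow>\<^sub>L ('a \<times> 'a)" is "\<lambda>p. (- snd p, fst p)"
  by (intro bounded_linear_Pair bounded_linear_minus bounded_linear_fst bounded_linear_snd)

definition cscale :: "complex \<Rightarrow> (('a::real_normed_vector \<times> 'a) \<Rightarrow>\<^sub>L ('a \<times> 'a))
    \<Rightarrow> (('a \<times> 'a) \<Rightarrow>\<^sub>L ('a \<times> 'a))" where
  "cscale w A = Re w *\<^sub>R A + Im w *\<^sub>R (cunit o\<^sub>L A)"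

definition sector :: "real \<Rightarrow> complex set" where
  "sector \<delta> = {z. z \<noteq> 0 \<and> \<bar>Arg z\<bar> < \<delta>}"

text \<open>
  An analytic semigroup extends from the half-line to a semigroup of bounded operators in an open
  sector, holomorphic in the operator norm there, and strongly continuous at \<open>0\<close> within the sector.
\<close>

definition analytic_semigroup :: "(real \<Rightarrow> 'a::banach \<Rightarrow>\<^sub>L 'a) \<Rightarrow> bool" where
  "analytic_semigroup S \<longleftrightarrow>
     c0_semigroup S \<and>
     (\<exists>\<delta> (E :: complex \<Rightarrow> (('a \<times> 'a) \<Rightarrow>\<^sub>L ('a \<times> 'a))).
        0 < \<delta> \<and> \<delta> \<le> pi / 2 \<and>
        (\<forall>t\<ge>0. \<forall>x y. blinfun_apply (E (of_real t)) (x, y)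
                     = (blinfun_apply (S t) x, blinfun_apply (S t) y)) \<and>
        (\<forall>z\<in>insert 0 (sector \<delta>). E z o\<^sub>L cunit = cunit o\<^sub>L E z) \<and>
        (\<forall>z\<in>insert 0 (sector \<delta>). \<forall>w\<in>insert 0 (sector \<delta>). E (z + w) = E z o\<^sub>L E w) \<and>
        (\<forall>z\<in>sector \<delta>. \<exists>A. (E has_derivative (\<lambda>w. cscale w A)) (at z)) \<and>
        (\<forall>v. ((\<lambda>z. blinfun_apply (E z) v) \<longlongrightarrow> v) (at 0 within sector \<delta>)))"

text \<open>An unbounded operator is given by its domain \<open>D\<close> and a function \<open>L\<close>, relevant on \<open>D\<close> only.\<close>

definition infinitesimal_generator ::
    "'a::banach set \<Rightarrow> ('a \<Rightarrow> 'a) \<Rightarrow> (real \<Rightarrow> 'a \<Rightarrow>\<^sub>L 'a) \<Rightarrow> bool" where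
  "infinitesimal_generator D L S \<longleftrightarrow>
     D = {x. \<exists>y. ((\<lambda>t. (blinfun_apply (S t) x - x) /\<^sub>R t) \<longlongrightarrow> y) (at_right 0)} \<and>
     (\<forall>x\<in>D. ((\<lambda>t. (blinfun_apply (S t) x - x) /\<^sub>R t) \<longlongrightarrow> L x) (at_right 0))"

section \<open>The initial value problem and its smoothness\<close>

definition solves_ivp ::
    "'a::banach set \<Rightarrow> ('a \<Rightarrow> 'a) \<Rightarrow> (real \<Rightarrow> 'a \<Rightarrow> 'a) \<Rightarrow> real \<Rightarrow> real \<Rightarrow> 'a \<Rightarrow> (real \<Rightarrow> 'a) \<Rightarrow> bool" where
  "solves_ivp D L N t0 T u0 u \<longleftrightarrow>
     u t0 = u0 \<and> continuous_on {t0..T} u \<and>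
     (\<forall>t\<in>{t0<..T}. u t \<in> D \<and>
        (u has_vector_derivative (L (u t) + N t (u t))) (at t within {t0..T}))"

definition smooth_curve :: "nat \<Rightarrow> real set \<Rightarrow> (real \<Rightarrow> 'a::real_normed_vector) \<Rightarrow> bool" where
  "smooth_curve K I u \<longleftrightarrow>
     (\<exists>du M. (\<forall>t\<in>I. du 0 t = u t) \<and>
        (\<forall>j<K. \<forall>t\<in>I. (du j has_vector_derivative du (Suc j) t) (at t within I)) \<and>
        (\<forall>j\<in>{1..K}. \<forall>t\<in>I. norm (du j t) \<le> M))"

text \<open>
  \<open>K\<close>-fold Frechet differentiability on \<open>W\<close> with uniformly bounded derivatives. The \<open>j\<close>-th derivative
  at \<open>x\<close> is the \<open>j\<close>-linear map \<open>F j x\<close>, whose arguments form a list of length \<open>j\<close>; it is the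
  derivative of the previous one with respect to the norm of \<open>j\<close>-linear maps, the new direction being
  the first argument.
\<close>

definition multilinear :: "nat \<Rightarrow> ('b::real_vector list \<Rightarrow> 'a::real_vector) \<Rightarrow> bool" where
  "multilinear j A \<longleftrightarrow>
     (\<forall>xs ys. length xs + length ys + 1 = j \<longrightarrow> linear (\<lambda>v. A (xs @ v # ys)))"

definition frechet_smooth ::
    "nat \<Rightarrow> 'b::real_normed_vector set \<Rightarrow> ('b \<Rightarrow> 'a::real_normed_vector) \<Rightarrow> bool" where
  "frechet_smooth K W f \<longleftrightarrow>
     (\<exists>(F :: nat \<Rightarrow> 'b \<Rightarrow> 'b list \<Rightarrow> 'a) M.
        (\<forall>x\<in>W. F 0 x [] = f x) \<and>
        (\<forall>j\<in>{1..K}. \<forall>x\<in>W. multilinear j (F j x) \<and>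
           (\<forall>vs. length vs = j \<longrightarrow> norm (F j x vs) \<le> M * prod_list (map norm vs))) \<and>
        (\<forall>j<K. \<forall>x\<in>W. \<forall>\<epsilon>>0. \<exists>d>0. \<forall>y\<in>W. norm (y - x) < d \<longrightarrow>
           (\<forall>vs. length vs = j \<longrightarrow>
              norm (F j y vs - F j x vs - F (Suc j) x ((y - x) # vs))
                \<le> \<epsilon> * norm (y - x) * prod_list (map norm vs))))"

definition smooth_along ::
    "nat \<Rightarrow> real \<Rightarrow> real \<Rightarrow> (real \<Rightarrow> 'a::real_normed_vector) \<Rightarrow> (real \<Rightarrow> 'a \<Rightarrow> 'a) \<Rightarrow> bool" where
  "smooth_along K t0 T u N \<longleftrightarrow>
     (\<exists>\<rho>>0. frechet_smooth K {(t, v). t \<in> {t0..T} \<and> norm (v - u t) \<le> \<rho>} (\<lambda>(t, v). N t v))"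

section \<open>Explicit exponential Runge--Kutta methods\<close>

text \<open>\<open>phi S k t\<close> is \<open>\<phi>\<^sub>k(t L)\<close> for \<open>k \<ge> 1\<close>, where \<open>S\<close> is the semigroup generated by \<open>L\<close>.\<close>

definition phi :: "(real \<Rightarrow> 'a::banach \<Rightarrow>\<^sub>L 'a) \<Rightarrow> nat \<Rightarrow> real \<Rightarrow> 'a \<Rightarrow> 'a" where
  "phi S k t x = integral {0..1}
     (\<lambda>\<theta>. (\<theta> ^ (k - 1) / fact (k - 1)) *\<^sub>R blinfun_apply (S ((1 - \<theta>) * t)) x)"

text \<open>
  The free data of a method: \<open>s\<close>, the nodes \<open>c\<^sub>i\<close>, the numbers \<open>\<ell>\<^sub>i\<^sub>j\<close> and \<open>m\<^sub>i\<close>, and the coefficients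
  \<open>\<alpha>\<^sub>i\<^sub>j\<^sup>(\<^sup>k\<^sup>)\<close> (arguments \<open>i j k\<close>) and \<open>\<beta>\<^sub>i\<^sup>(\<^sup>k\<^sup>)\<close> (arguments \<open>i k\<close>).
\<close>

record exprk =
  stages :: nat
  node :: "nat \<Rightarrow> real"
  alen :: "nat \<Rightarrow> nat \<Rightarrow> nat"
  alpha :: "nat \<Rightarrow> nat \<Rightarrow> nat \<Rightarrow> real"
  blen :: "nat \<Rightarrow> nat"
  beta :: "nat \<Rightarrow> nat \<Rightarrow> real"

text \<open>
  Nodes lie in the unit interval: a negative node would require the semigroup at negative times, and
  a node beyond \<open>1\<close> would require the nonlinearity at times beyond \<open>T\<close>.
\<close>

definition exprk_method :: "exprk \<Rightarrow> bool" where
  "exprk_method R \<longleftrightarrow>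
     1 \<le> stages R \<and> node R 1 = 0 \<and> (\<forall>i\<in>{2..stages R}. 0 < node R i \<and> node R i \<le> 1)"

definition exprk_a ::
    "(real \<Rightarrow> 'a::banach \<Rightarrow>\<^sub>L 'a) \<Rightarrow> exprk \<Rightarrow> real \<Rightarrow> nat \<Rightarrow> nat \<Rightarrow> 'a \<Rightarrow> 'a" where
  "exprk_a S R H i j x =
     (let a = (\<lambda>j. \<Sum>k=1..alen R i j. alpha R i j k *\<^sub>R phi S k (node R i * H) x)
      in if j = 1 then node R i *\<^sub>R phi S 1 (node R i * H) x - (\<Sum>j=2..<i. a j) else a j)"

definition exprk_b ::
    "(real \<Rightarrow> 'a::banach \<Rightarrow>\<^sub>L 'a) \<Rightarrow> exprk \<Rightarrow> real \<Rightarrow> nat \<Rightarrow> 'a \<Rightarrow> 'a" where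
  "exprk_b S R H i x =
     (let b = (\<lambda>i. \<Sum>k=1..blen R i. beta R i k *\<^sub>R phi S k H x)
      in if i = 1 then phi S 1 H x - (\<Sum>i=2..stages R. b i) else b i)"

text \<open>Stage \<open>i\<close> and result of one step of size \<open>H\<close> from the value \<open>v\<close> at time \<open>t\<close>.\<close>

fun exprk_stage ::
    "(real \<Rightarrow> 'a::banach \<Rightarrow>\<^sub>L 'a) \<Rightarrow> (real \<Rightarrow> 'a \<Rightarrow> 'a) \<Rightarrow> exprk \<Rightarrow> real \<Rightarrow> real \<Rightarrow> 'a \<Rightarrow> nat \<Rightarrow> 'a" where
  "exprk_stage S N R H t v i =
     blinfun_apply (S (node R i * H)) v
     + H *\<^sub>R (\<Sum>j\<in>{1..<i}. exprk_a S R H i j (N (t + node R j * H) (exprk_stage S N R H t v j)))"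

declare exprk_stage.simps [simp del]

definition exprk_step ::
    "(real \<Rightarrow> 'a::banach \<Rightarrow>\<^sub>L 'a) \<Rightarrow> (real \<Rightarrow> 'a \<Rightarrow> 'a) \<Rightarrow> exprk \<Rightarrow> real \<Rightarrow> real \<Rightarrow> 'a \<Rightarrow> 'a" where
  "exprk_step S N R H t v =
     blinfun_apply (S H) v
     + H *\<^sub>R (\<Sum>i=1..stages R. exprk_b S R H i (N (t + node R i * H) (exprk_stage S N R H t v i)))"

primrec exprk_seq ::
    "(real \<Rightarrow> 'a::banach \<Rightarrow>\<^sub>L 'a) \<Rightarrow> (real \<Rightarrow> 'a \<Rightarrow> 'a) \<Rightarrow> exprk \<Rightarrow> real \<Rightarrow> 'a \<Rightarrow> real \<Rightarrow> nat \<Rightarrow> 'a" where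
  "exprk_seq S N R t0 u0 H 0 = u0"
| "exprk_seq S N R t0 u0 H (Suc n) =
     exprk_step S N R H (t0 + real n * H) (exprk_seq S N R t0 u0 H n)"

text \<open>
  Order \<open>p\<close> on the given problem: global error \<open>O(H\<^sup>p)\<close> together with local error \<open>O(H\<^sup>p\<^sup>+\<^sup>1)\<close>, both
  uniformly in the step number, as the step size tends to \<open>0\<close>.
\<close>

definition exprk_global_order ::
    "(real \<Rightarrow> 'a::banach \<Rightarrow>\<^sub>L 'a) \<Rightarrow> (real \<Rightarrow> 'a \<Rightarrow> 'a) \<Rightarrow> real \<Rightarrow> real \<Rightarrow> (real \<Rightarrow> 'a) \<Rightarrow> exprk \<Rightarrow> nat \<Rightarrow> bool"
  where
  "exprk_global_order S N t0 T u R p \<longleftrightarrow>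
     (\<exists>C H0. 0 < H0 \<and> (\<forall>H n. 0 < H \<and> H \<le> H0 \<and> t0 + real n * H \<le> T \<longrightarrow>
        norm (exprk_seq S N R t0 (u t0) H n - u (t0 + real n * H)) \<le> C * H ^ p)) \<and>
     (\<exists>C H0. 0 < H0 \<and> (\<forall>H n. 0 < H \<and> H \<le> H0 \<and> t0 + real (Suc n) * H \<le> T \<longrightarrow>
        norm (exprk_step S N R H (t0 + real n * H) (u (t0 + real n * H)) - u (t0 + real (Suc n) * H))
          \<le> C * H ^ (p + 1)))"

section \<open>MERK methods\<close>

text \<open>Solution of \<open>y' = L y + f\<close>, \<open>y(0) = v\<close> by the variation-of-constants formula.\<close>

definition var_const ::
    "(real \<Rightarrow> 'a::banach \<Rightarrow>\<^sub>L 'a) \<Rightarrow> (real \<Rightarrow> 'a) \<Rightarrow> 'a \<Rightarrow> real \<Rightarrow> 'a" where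
  "var_const S f v \<tau> =
     blinfun_apply (S \<tau>) v + integral {0..\<tau>} (\<lambda>\<sigma>. blinfun_apply (S (\<tau> - \<sigma>)) (f \<sigma>))"

text \<open>
  In the following, \<open>v\<close> and \<open>V i\<close> are the numerical value at time \<open>t\<close> and the numerical stages of the
  current step.
\<close>

definition merk_D :: "(real \<Rightarrow> 'a \<Rightarrow> 'a) \<Rightarrow> exprk \<Rightarrow> real \<Rightarrow> real \<Rightarrow> 'a::banach \<Rightarrow> (nat \<Rightarrow> 'a) \<Rightarrow> nat \<Rightarrow> 'a" where
  "merk_D N R H t v V i = N (t + node R i * H) (V i) - N t v"

definition merk_p ::
    "(real \<Rightarrow> 'a \<Rightarrow> 'a) \<Rightarrow> exprk \<Rightarrow> real \<Rightarrow> real \<Rightarrow> 'a::banach \<Rightarrow> (nat \<Rightarrow> 'a) \<Rightarrow> nat \<Rightarrow> real \<Rightarrow> 'a" where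
  "merk_p N R H t v V i \<tau> = N t v +
     (\<Sum>j=2..<i. (\<Sum>k=1..alen R i j.
         alpha R i j k / (node R i ^ k * H ^ (k - 1) * fact (k - 1)) * \<tau> ^ (k - 1))
       *\<^sub>R merk_D N R H t v V j)"

definition merk_q ::
    "(real \<Rightarrow> 'a \<Rightarrow> 'a) \<Rightarrow> exprk \<Rightarrow> real \<Rightarrow> real \<Rightarrow> 'a::banach \<Rightarrow> (nat \<Rightarrow> 'a) \<Rightarrow> real \<Rightarrow> 'a" where
  "merk_q N R H t v V \<tau> = N t v +
     (\<Sum>i=2..stages R. (\<Sum>k=1..blen R i.
         beta R i k / (H ^ (k - 1) * fact (k - 1)) * \<tau> ^ (k - 1))
       *\<^sub>R merk_D N R H t v V i)"

text \<open>
  \<open>w n\<close> and \<open>W n i\<close> are the approximations and stages produced on \<open>[t0, T]\<close> by a MERK method whose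
  fast problems are integrated by solvers of orders \<open>q\<close> (stages) and \<open>r\<close> (step) with micro step \<open>h\<close>
  and error constants \<open>c2\<close> and \<open>c3\<close>.
\<close>

definition merk_run ::
    "(real \<Rightarrow> 'a::banach \<Rightarrow>\<^sub>L 'a) \<Rightarrow> (real \<Rightarrow> 'a \<Rightarrow> 'a) \<Rightarrow> real \<Rightarrow> real \<Rightarrow> 'a \<Rightarrow> exprk
      \<Rightarrow> nat \<Rightarrow> nat \<Rightarrow> real \<Rightarrow> real \<Rightarrow> real \<Rightarrow> real \<Rightarrow> (nat \<Rightarrow> 'a) \<Rightarrow> (nat \<Rightarrow> nat \<Rightarrow> 'a) \<Rightarrow> bool" where
  "merk_run S N t0 T u0 R q r c2 c3 H h w W \<longleftrightarrow>
     w 0 = u0 \<and>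
     (\<forall>n. t0 + real (Suc n) * H \<le> T \<longrightarrow>
        W n 1 = w n \<and>
        (\<forall>i\<in>{2..stages R}.
           norm (W n i - var_const S (merk_p N R H (t0 + real n * H) (w n) (W n) i) (w n) (node R i * H))
             \<le> c2 * H * h ^ q) \<and>
        norm (w (Suc n) - var_const S (merk_q N R H (t0 + real n * H) (w n) (W n)) (w n) H)
          \<le> c3 * H * h ^ r)"

definition merk_convergent ::
    "(real \<Rightarrow> 'a::banach \<Rightarrow>\<^sub>L 'a) \<Rightarrow> (real \<Rightarrow> 'a \<Rightarrow> 'a) \<Rightarrow> real \<Rightarrow> real \<Rightarrow> (real \<Rightarrow> 'a) \<Rightarrow> exprk
      \<Rightarrow> nat \<Rightarrow> nat \<Rightarrow> real \<Rightarrow> real \<Rightarrow> bool" where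
  "merk_convergent S N t0 T u R q r c2 c3 \<longleftrightarrow>
     (\<forall>\<epsilon>>0. \<exists>H0>0. \<forall>H (m::nat) w W n.
        0 < H \<and> H \<le> H0 \<and> 1 \<le> m \<and> merk_run S N t0 T (u t0) R q r c2 c3 H (H / real m) w W \<and>
        t0 + real n * H \<le> T \<longrightarrow> norm (w n - u (t0 + real n * H)) < \<epsilon>)"

end

theory Submission
  imports Defs
begin

text \<open>
  A MERK method is a perturbed exponential Runge--Kutta method. The polynomials in its fast problems
  are chosen such that the variation-of-constants integral of each monomial is a \<open>\<phi>\<close>-function, so
  exact solution of the fast problems gives back the Runge--Kutta stages and step
  (\<open>var_const_merk_p\<close>, \<open>var_const_merk_q\<close>). Solver errors \<open>c\<^sub>2 H h\<^sup>q\<close> and \<open>c\<^sub>3 H h\<^sup>r\<close> are residuals in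
  these formulas, and the theorem is the classical argument "consistency and stability imply
  convergence".

  Stability: near the solution the nonlinearity is Lipschitz, and the coefficient operators are
  uniformly bounded. Hence residuals \<open>\<epsilon>\<close> in the stages and an initial error \<open>e\<^sub>n\<close> change the step by
  \<open>S H e\<^sub>n\<close> plus at most \<open>H \<Gamma> (\<parallel>e\<^sub>n\<parallel> + \<epsilon>)\<close> (\<open>step_stable\<close>). With the local error
  \<open>C H\<^sup>p\<^sup>+\<^sup>1\<close> of the base method this gives \<open>e\<^sub>n\<^sub>+\<^sub>1 = S H e\<^sub>n + d\<^sub>n\<close>, where
  \<open>\<parallel>d\<^sub>n\<parallel> \<le> H (\<Gamma> \<parallel>e\<^sub>n\<parallel> + C H\<^sup>p + \<Gamma> c\<^sub>2 H h\<^sup>q + c\<^sub>3 h\<^sup>r)\<close> (\<open>merk_defect\<close>). The recursion is solved explicitly,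
  the semigroup is bounded on compact time intervals, and a discrete Gronwall inequality yields the
  bound (\<open>merk_error_bound\<close>).

  The Lipschitz estimates presuppose that all stages lie in the strip along the solution. For the
  stages of the base method started on the solution this holds for small \<open>H\<close>, by strong continuity,
  uniform on the compact range of the solution (\<open>exact_stages_near_solution\<close>). For the MERK stages it
  follows from the error bound at the earlier steps, which is why \<open>discrete_gronwall\<close> has the form of a
  bootstrap argument.
\<close>

section \<open>Strongly continuous semigroups on compact time intervals\<close>

text \<open>
  A case of uniform boundedness. By strong continuity at \<open>0\<close>, each \<open>x\<close> lies in one of the closed sets
  of points that \<open>S t\<close>, for \<open>t \<le> 1/(n+1)\<close>, maps into the ball of radius \<open>n\<close>. One of them
  contains a ball by Baire's theorem, and differences of its points bound the operator norm.
\<close>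

lemma c0_semigroup_bounded_near_zero:
  fixes S :: "real \<Rightarrow> 'a::banach \<Rightarrow>\<^sub>L 'a"
  assumes "c0_semigroup S"
  obtains d M where "0 < d" "1 \<le> M" "\<And>t. 0 \<le> t \<Longrightarrow> t \<le> d \<Longrightarrow> norm (S t) \<le> M"
proof -
  have S0: "S 0 = id_blinfun" and lim: "\<And>x. ((\<lambda>t. blinfun_apply (S t) x) \<longlongrightarrow> x) (at_right 0)"
    using assms by (auto simp: c0_semigroup_def)
  define A where "A n = {x. \<forall>t\<in>{0<..1 / real (Suc n)}. norm (blinfun_apply (S t) x) \<le> real n}" for n
  have closed: "closed (A n)" for n
  proof -
    have "A n = (\<Inter>t\<in>{0<..1 / real (Suc n)}. {x. norm (blinfun_apply (S t) x) \<le> real n})"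
      by (auto simp: A_def)
    then show ?thesis
      by (auto intro!: closed_INT closed_Collect_le continuous_intros)
  qed
  have cover: "\<exists>n. x \<in> A n" for x
  proof -
    have "\<forall>\<^sub>F t in at_right 0. norm (blinfun_apply (S t) x) < norm x + 1"
      by (rule order_tendstoD(2)[OF tendsto_norm[OF lim]]) simp
    then obtain b where b: "0 < b" "\<And>t. 0 < t \<Longrightarrow> t < b \<Longrightarrow> norm (blinfun_apply (S t) x) < norm x + 1"
      unfolding eventually_at_right_field by auto
    obtain n where n: "real n > max (1 / b) (norm x + 1)"
      using reals_Archimedean2 by blast
    have "norm (blinfun_apply (S t) x) \<le> real n" if t: "t \<in> {0<..1 / real (Suc n)}" for t
    proof -
      have "1 / real (Suc n) < b"
      proof -
        have "1 / b < real (Suc n)" using n by simp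
        then show ?thesis using b(1) by (simp add: field_simps)
      qed
      then have "norm (blinfun_apply (S t) x) < norm x + 1"
        using t by (intro b) auto
      then show ?thesis using n by simp
    qed
    then show ?thesis by (auto simp: A_def intro!: exI[of _ n])
  qed
  have "\<exists>n. interior (A n) \<noteq> {}"
  proof (rule ccontr)
    assume "\<not> ?thesis"
    then have "euclidean interior_of (\<Union>(range A)) = {}"
      using closed completely_metrizable_space_euclidean
      by (intro Baire_category_alt) auto
    moreover have "\<Union>(range A) = UNIV" using cover by auto
    ultimately show False by simp
  qed
  then obtain n x0 where "x0 \<in> interior (A n)" by blast
  then obtain r where r: "0 < r" "cball x0 r \<subseteq> A n"
    by (meson mem_interior_cball)
  have bound: "norm (S t) \<le> 2 * real n / r" if t: "t \<in> {0<..1 / real (Suc n)}" for t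
  proof (rule norm_blinfun_bound)
    show "0 \<le> 2 * real n / r" using r by simp
    fix x
    show "norm (blinfun_apply (S t) x) \<le> 2 * real n / r * norm x"
    proof (cases "x = 0")
      case False
      define y where "y = (r / norm x) *\<^sub>R x"
      have "x0 + y \<in> A n" "x0 \<in> A n"
        using r False by (auto simp: y_def dist_norm subset_iff)
      then have "norm (blinfun_apply (S t) (x0 + y) - blinfun_apply (S t) x0) \<le> real n + real n"
        using t by (intro order_trans[OF norm_triangle_ineq4] add_mono) (auto simp: A_def)
      then have "norm (blinfun_apply (S t) y) \<le> 2 * real n"
        by (simp add: blinfun.add_right)
      moreover have "blinfun_apply (S t) x = (norm x / r) *\<^sub>R blinfun_apply (S t) y"
        using False r by (simp add: y_def blinfun.scaleR_right)
      ultimately show ?thesis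
        using r mult_left_mono[of "norm (blinfun_apply (S t) y)" "2 * real n" "norm x / r"]
        by (simp add: mult_ac)
    qed simp
  qed
  show ?thesis
  proof
    show "0 < 1 / real (Suc n)" by simp
    show "1 \<le> max 1 (2 * real n / r)" by simp
    fix t :: real assume "0 \<le> t" "t \<le> 1 / real (Suc n)"
    then show "norm (S t) \<le> max 1 (2 * real n / r)"
      using bound[of t] S0 norm_blinfun_id_le[where ?'a='a] by (cases "t = 0") (auto simp: le_max_iff_disj)
  qed
qed

lemma c0_semigroup_bounded:
  fixes S :: "real \<Rightarrow> 'a::banach \<Rightarrow>\<^sub>L 'a"
  assumes "c0_semigroup S"
  obtains M where "1 \<le> M" "\<And>t. 0 \<le> t \<Longrightarrow> t \<le> b \<Longrightarrow> norm (S t) \<le> M"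
proof -
  obtain d M where d: "0 < d" and M: "1 \<le> M" and bd: "\<And>t. 0 \<le> t \<Longrightarrow> t \<le> d \<Longrightarrow> norm (S t) \<le> M"
    using c0_semigroup_bounded_near_zero[OF assms] by blast
  have semi: "S (s + t) = S s o\<^sub>L S t" if "0 \<le> s" "0 \<le> t" for s t
    using assms that by (auto simp: c0_semigroup_def)
  have *: "\<forall>t. 0 \<le> t \<longrightarrow> t \<le> real n * d \<longrightarrow> norm (S t) \<le> M ^ Suc n" for n
  proof (induction n)
    case 0
    then show ?case using bd[of 0] d by auto
  next
    case (Suc n)
    show ?case
    proof (intro allI impI)
      fix t assume t: "0 \<le> t" "t \<le> real (Suc n) * d"
      show "norm (S t) \<le> M ^ Suc (Suc n)"
      proof (cases "t \<le> d")
        case True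
        then show ?thesis using bd[of t] t M
          by (meson Suc_le_eq order_trans self_le_power zero_less_Suc)
      next
        case False
        have "S t = S d o\<^sub>L S (t - d)"
          using semi[of d "t - d"] False d by simp
        also have "norm \<dots> \<le> norm (S d) * norm (S (t - d))"
          by (rule norm_blinfun_compose)
        also have "\<dots> \<le> M * M ^ Suc n"
        proof (rule mult_mono)
          have "t - d \<le> real n * d" using t by (simp add: algebra_simps)
          then show "norm (S (t - d)) \<le> M ^ Suc n" using Suc False by simp
        qed (use bd d M in auto)
        finally show ?thesis by simp
      qed
    qed
  qed
  obtain n where "b < real n * d"
    using reals_Archimedean3[OF d] by blast
  then show ?thesis
    using * [of n] M by (intro that[of "M ^ Suc n"]) (auto simp: one_le_power simp del: power_Suc)
qed

lemma c0_semigroup_continuous_on: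
  fixes S :: "real \<Rightarrow> 'a::banach \<Rightarrow>\<^sub>L 'a"
  assumes "c0_semigroup S"
  shows "continuous_on {0..b} (\<lambda>t. blinfun_apply (S t) x)"
  unfolding continuous_on_iff
proof (intro ballI allI impI)
  fix s e :: real assume s: "s \<in> {0..b}" and e: "0 < e"
  have semi: "\<And>s t. 0 \<le> s \<Longrightarrow> 0 \<le> t \<Longrightarrow> S (s + t) = S s o\<^sub>L S t"
    and lim: "((\<lambda>t. blinfun_apply (S t) x) \<longlongrightarrow> x) (at_right 0)"
    using assms by (auto simp: c0_semigroup_def)
  obtain M where M: "1 \<le> M" and bd: "\<And>t. 0 \<le> t \<Longrightarrow> t \<le> b \<Longrightarrow> norm (S t) \<le> M"
    using c0_semigroup_bounded[OF assms, of b] by blast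
  have "\<forall>\<^sub>F t in at_right 0. dist (blinfun_apply (S t) x) x < e / M"
    using tendstoD[OF lim, of "e / M"] e M by simp
  then obtain d where d: "0 < d" and small: "\<And>t. 0 < t \<Longrightarrow> t < d \<Longrightarrow> dist (blinfun_apply (S t) x) x < e / M"
    unfolding eventually_at_right_field by auto
  have gap: "dist (blinfun_apply (S t) x) (blinfun_apply (S r) x) < e"
    if "0 \<le> r" "r < t" "t \<le> b" "t - r < d" for r t
  proof -
    have "blinfun_apply (S t) x - blinfun_apply (S r) x = blinfun_apply (S r) (blinfun_apply (S (t - r)) x - x)"
      using semi[of r "t - r"] that by (simp add: blinfun.diff_right)
    also have "norm \<dots> \<le> norm (S r) * norm (blinfun_apply (S (t - r)) x - x)"
      by (rule norm_blinfun)
    also have "\<dots> \<le> M * norm (blinfun_apply (S (t - r)) x - x)"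
      using that by (intro mult_right_mono bd) auto
    also have "\<dots> < M * (e / M)"
      using small[of "t - r"] that M by (intro mult_strict_left_mono) (auto simp: dist_norm)
    finally show ?thesis using M by (simp add: dist_norm)
  qed
  show "\<exists>d>0. \<forall>t\<in>{0..b}. dist t s < d \<longrightarrow> dist (blinfun_apply (S t) x) (blinfun_apply (S s) x) < e"
  proof (intro exI[of _ d] conjI ballI impI d)
    fix t assume "t \<in> {0..b}" "dist t s < d"
    then show "dist (blinfun_apply (S t) x) (blinfun_apply (S s) x) < e"
      using gap[of s t] gap[of t s] s e
      by (cases s t rule: linorder_cases) (auto simp: dist_commute dist_real_def)
  qed
qed

text \<open>
  On a compact set the convergence \<open>S \<tau> x \<rightarrow> x\<close> is uniform, because \<open>S\<close> is locally bounded and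
  hence jointly continuous in \<open>(\<tau>, x)\<close>.
\<close>

lemma c0_semigroup_uniform_at_zero:
  fixes S :: "real \<Rightarrow> 'a::banach \<Rightarrow>\<^sub>L 'a"
  assumes c0: "c0_semigroup S" and C: "compact C" and e: "0 < e"
  obtains d where "0 < d" "\<And>\<tau> x. 0 \<le> \<tau> \<Longrightarrow> \<tau> \<le> d \<Longrightarrow> x \<in> C \<Longrightarrow> norm (blinfun_apply (S \<tau>) x - x) < e"
proof -
  obtain M where M: "1 \<le> M" and bd: "\<And>t. 0 \<le> t \<Longrightarrow> t \<le> 1 \<Longrightarrow> norm (S t) \<le> M"
    using c0_semigroup_bounded[OF c0, of 1] by blast
  have "continuous_on ({0..1} \<times> C) (\<lambda>(\<tau>, x). blinfun_apply (S \<tau>) x)"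
    unfolding continuous_on_iff
  proof clarify
    fix s x and \<epsilon> :: real assume s: "s \<in> {0..1::real}" and x: "x \<in> C" and \<epsilon>: "0 < \<epsilon>"
    obtain d where d: "0 < d" and near: "\<And>t. t \<in> {0..1} \<Longrightarrow> dist t s < d \<Longrightarrow>
        dist (blinfun_apply (S t) x) (blinfun_apply (S s) x) < \<epsilon> / 2"
      using c0_semigroup_continuous_on[OF c0, of 1 x] s \<epsilon> unfolding continuous_on_iff
      by (meson half_gt_zero)
    show "\<exists>d>0. \<forall>p\<in>{0..1} \<times> C. dist p (s, x) < d \<longrightarrow>
        dist (case p of (\<tau>, x) \<Rightarrow> blinfun_apply (S \<tau>) x) (blinfun_apply (S s) x) < \<epsilon>"
    proof (intro exI[of _ "min d (\<epsilon> / (2 * M))"] conjI ballI impI)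
      fix p assume p: "p \<in> {0..1} \<times> C" "dist p (s, x) < min d (\<epsilon> / (2 * M))"
      obtain t y where [simp]: "p = (t, y)" by (cases p)
      have t: "dist t s < d" and y: "dist y x < \<epsilon> / (2 * M)"
        using dist_fst_le[of p "(s, x)"] dist_snd_le[of p "(s, x)"] p by auto
      have "norm (blinfun_apply (S t) (y - x)) \<le> M * norm (y - x)"
        using p bd[of t] by (intro order_trans[OF norm_blinfun] mult_right_mono) auto
      also have "\<dots> < \<epsilon> / 2"
        using y M by (simp add: dist_norm field_simps)
      finally have "dist (blinfun_apply (S t) y) (blinfun_apply (S t) x) < \<epsilon> / 2"
        by (simp add: dist_norm blinfun.diff_right)
      moreover have "dist (blinfun_apply (S t) x) (blinfun_apply (S s) x) < \<epsilon> / 2"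
        using p t by (intro near) auto
      ultimately have "dist (blinfun_apply (S t) y) (blinfun_apply (S s) x) < \<epsilon> / 2 + \<epsilon> / 2"
        by (meson add_strict_mono dist_triangle le_less_trans)
      then show "dist (case p of (\<tau>, x) \<Rightarrow> blinfun_apply (S \<tau>) x) (blinfun_apply (S s) x) < \<epsilon>"
        by simp
    qed (use d \<epsilon> M in auto)
  qed
  then have "uniformly_continuous_on ({0..1} \<times> C) (\<lambda>(\<tau>, x). blinfun_apply (S \<tau>) x)"
    by (intro compact_uniformly_continuous compact_Times C) auto
  then obtain d where d: "0 < d" and uc: "\<And>p p'. p \<in> {0..1} \<times> C \<Longrightarrow> p' \<in> {0..1} \<times> C \<Longrightarrow> dist p' p < d \<Longrightarrow>
      dist (case p' of (\<tau>, x) \<Rightarrow> blinfun_apply (S \<tau>) x) (case p of (\<tau>, x) \<Rightarrow> blinfun_apply (S \<tau>) x) < e"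
    using e unfolding uniformly_continuous_on_def by meson
  show ?thesis
  proof
    show "0 < min 1 (d / 2)" using d by simp
    fix \<tau> x assume "0 \<le> \<tau>" "\<tau> \<le> min 1 (d / 2)" "x \<in> C"
    then show "norm (blinfun_apply (S \<tau>) x - x) < e"
      using uc[of "(0, x)" "(\<tau>, x)"] d c0
      by (simp add: dist_Pair_Pair dist_norm c0_semigroup_def)
  qed
qed

section \<open>The coefficient operators\<close>

lemma continuous_on_phi_integrand:
  fixes S :: "real \<Rightarrow> 'a::banach \<Rightarrow>\<^sub>L 'a"
  assumes "c0_semigroup S" "0 \<le> t"
  shows "continuous_on {0..1} (\<lambda>\<theta>. (\<theta> ^ (k - 1) / fact (k - 1)) *\<^sub>R blinfun_apply (S ((1 - \<theta>) * t)) x)"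
proof -
  have "continuous_on {0..1} (\<lambda>\<theta>. blinfun_apply (S ((1 - \<theta>) * t)) x)"
    by (rule continuous_on_compose2[OF c0_semigroup_continuous_on[OF assms(1), of t x]])
      (use assms(2) in \<open>auto simp: mult_left_le_one_le intro!: continuous_intros\<close>)
  then show ?thesis
    by (intro continuous_on_scaleR) (auto intro!: continuous_intros)
qed

lemma phi_has_integral:
  fixes S :: "real \<Rightarrow> 'a::banach \<Rightarrow>\<^sub>L 'a"
  assumes "c0_semigroup S" "0 \<le> t"
  shows "((\<lambda>\<theta>. (\<theta> ^ (k - 1) / fact (k - 1)) *\<^sub>R blinfun_apply (S ((1 - \<theta>) * t)) x)
     has_integral phi S k t x) {0..1}"
  unfolding phi_def
  by (intro integrable_integral integrable_continuous_interval continuous_on_phi_integrand assms)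

lemma linear_phi:
  fixes S :: "real \<Rightarrow> 'a::banach \<Rightarrow>\<^sub>L 'a"
  assumes "c0_semigroup S" "0 \<le> t"
  shows "linear (phi S k t)"
proof (rule linearI)
  note I = phi_has_integral[OF assms]
  show "phi S k t (x + y) = phi S k t x + phi S k t y" for x y
    using has_integral_add[OF I[of k x] I[of k y]] I[of k "x + y"]
    by (simp add: blinfun.add_right scaleR_add_right has_integral_unique)
  show "phi S k t (r *\<^sub>R x) = r *\<^sub>R phi S k t x" for r x
    using has_integral_cmul[OF I[of k x], of r] I[of k "r *\<^sub>R x"]
    by (simp add: blinfun.scaleR_right mult.commute has_integral_unique)
qed

lemma norm_phi_le:
  fixes S :: "real \<Rightarrow> 'a::banach \<Rightarrow>\<^sub>L 'a"
  assumes "c0_semigroup S" "0 \<le> t" and M: "\<And>s. 0 \<le> s \<Longrightarrow> s \<le> t \<Longrightarrow> norm (S s) \<le> M"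
  shows "norm (phi S k t x) \<le> M * norm x"
proof -
  have "norm ((\<theta> ^ (k - 1) / fact (k - 1)) *\<^sub>R blinfun_apply (S ((1 - \<theta>) * t)) x) \<le> M * norm x"
    if \<theta>: "\<theta> \<in> {0..1}" for \<theta>
  proof -
    have "norm (blinfun_apply (S ((1 - \<theta>) * t)) x) \<le> M * norm x"
      using \<theta> assms(2)
      by (intro order_trans[OF norm_blinfun] mult_right_mono M) (auto simp: algebra_simps mult_left_le_one_le)
    moreover have "\<theta> ^ (k - 1) / fact (k - 1) \<le> 1" "0 \<le> \<theta> ^ (k - 1) / fact (k - 1)"
      using \<theta> order_trans[OF power_le_one[of \<theta> "k - 1"] fact_ge_1[of "k - 1"]] by auto
    ultimately have "(\<theta> ^ (k - 1) / fact (k - 1)) * norm (blinfun_apply (S ((1 - \<theta>) * t)) x) \<le> 1 * (M * norm x)"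
      by (intro mult_mono) auto
    then show ?thesis
      using \<theta> by simp
  qed
  then have "norm (phi S k t x) \<le> M * norm x * (1 - 0)"
    unfolding phi_def
    by (intro integral_bound continuous_on_phi_integrand assms) auto
  then show ?thesis by simp
qed

text \<open>The substitution \<open>\<sigma> = \<theta> c H\<close> turns a monomial forcing into a \<open>\<phi>\<close>-function.\<close>

lemma monomial_forcing_has_integral:
  fixes S :: "real \<Rightarrow> 'a::banach \<Rightarrow>\<^sub>L 'a"
  assumes c0: "c0_semigroup S" and c: "0 < c" and H: "0 < H" and k: "1 \<le> k"
  shows "((\<lambda>\<sigma>. (1 / (c ^ k * H ^ (k - 1) * fact (k - 1)) * \<sigma> ^ (k - 1)) *\<^sub>R blinfun_apply (S (c * H - \<sigma>)) x)
     has_integral H *\<^sub>R phi S k (c * H) x) {0..c * H}"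
proof -
  let ?f = "\<lambda>\<theta>. (\<theta> ^ (k - 1) / fact (k - 1)) *\<^sub>R blinfun_apply (S ((1 - \<theta>) * (c * H))) x"
  have "0 \<le> c * H" using c H by simp
  have cH: "c ^ k = c * c ^ (k - 1)" using k by (cases k) auto
  have "(?f has_integral phi S k (c * H) x) (cbox 0 1)"
    using phi_has_integral[OF c0 \<open>0 \<le> c * H\<close>, of k x] by simp
  from has_integral_affinity'[OF this, of "1 / (c * H)" 0] c H
  have "((\<lambda>\<sigma>. ?f (\<sigma> / (c * H))) has_integral (c * H) *\<^sub>R phi S k (c * H) x) {0..c * H}"
    by simp
  then have I: "((\<lambda>\<sigma>. (1 / c) *\<^sub>R ?f (\<sigma> / (c * H))) has_integral (1 / c) *\<^sub>R ((c * H) *\<^sub>R phi S k (c * H) x)) {0..c * H}"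
    by (rule has_integral_cmul)
  have V: "(1 / c) *\<^sub>R ((c * H) *\<^sub>R phi S k (c * H) x) = H *\<^sub>R phi S k (c * H) x"
    using c by simp
  have E: "(1 / c) *\<^sub>R ?f (\<sigma> / (c * H)) =
      (1 / (c ^ k * H ^ (k - 1) * fact (k - 1)) * \<sigma> ^ (k - 1)) *\<^sub>R blinfun_apply (S (c * H - \<sigma>)) x" for \<sigma>
  proof -
    have "(1 - \<sigma> / (c * H)) * (c * H) = c * H - \<sigma>" using c H by (simp add: field_simps)
    moreover have "1 / c * ((\<sigma> / (c * H)) ^ (k - 1) / fact (k - 1))
        = 1 / (c ^ k * H ^ (k - 1) * fact (k - 1)) * \<sigma> ^ (k - 1)"
      unfolding cH by (simp add: power_divide power_mult_distrib)
    ultimately show ?thesis by (simp only: scaleR_scaleR)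
  qed
  show ?thesis
    by (rule has_integral_eq[OF E I[unfolded V]])
qed

lemma var_const_polynomial_forcing:
  fixes S :: "real \<Rightarrow> 'a::banach \<Rightarrow>\<^sub>L 'a"
  assumes c0: "c0_semigroup S" and c: "0 < c" and H: "0 < H" and J: "finite J"
  shows "var_const S (\<lambda>\<tau>. x + (\<Sum>j\<in>J. (\<Sum>k=1..l j. g j k / (c ^ k * H ^ (k - 1) * fact (k - 1)) * \<tau> ^ (k - 1))
            *\<^sub>R d j)) v (c * H)
    = blinfun_apply (S (c * H)) v
      + H *\<^sub>R (c *\<^sub>R phi S 1 (c * H) x + (\<Sum>j\<in>J. \<Sum>k=1..l j. g j k *\<^sub>R phi S k (c * H) (d j)))"
proof -
  let ?m = "\<lambda>k \<sigma> x. (1 / (c ^ k * H ^ (k - 1) * fact (k - 1)) * \<sigma> ^ (k - 1)) *\<^sub>R blinfun_apply (S (c * H - \<sigma>)) x"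
  let ?F = "\<lambda>\<sigma>. c *\<^sub>R ?m 1 \<sigma> x + (\<Sum>j\<in>J. \<Sum>k=1..l j. g j k *\<^sub>R ?m k \<sigma> (d j))"
  have "(?F has_integral
      (c *\<^sub>R H *\<^sub>R phi S 1 (c * H) x + (\<Sum>j\<in>J. \<Sum>k=1..l j. g j k *\<^sub>R H *\<^sub>R phi S k (c * H) (d j)))) {0..c * H}"
    by (intro has_integral_add has_integral_sum has_integral_cmul monomial_forcing_has_integral assms) auto
  moreover have "?F = (\<lambda>\<sigma>. blinfun_apply (S (c * H - \<sigma>))
     (x + (\<Sum>j\<in>J. (\<Sum>k=1..l j. g j k / (c ^ k * H ^ (k - 1) * fact (k - 1)) * \<sigma> ^ (k - 1)) *\<^sub>R d j)))"
    using c by (simp add: blinfun.add_right blinfun.sum_right blinfun.scaleR_right scaleR_sum_left fun_eq_iff)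
  ultimately show ?thesis
    unfolding var_const_def
    by (simp add: integral_unique scaleR_add_right scaleR_sum_right ac_simps)
qed

text \<open>
  The fast problems contain differences with the first value of the nonlinearity. The Runge--Kutta
  formulas contain the values themselves, and the first weight, which is \<open>c \<phi>\<^sub>1(c H L)\<close> minus
  all other weights, makes up for this.
\<close>

lemma weights_on_differences:
  fixes x :: "'a::real_vector" and P :: "'a \<Rightarrow> 'a"
  assumes "\<And>j. j \<in> J \<Longrightarrow> linear (a j)"
  shows "P x + (\<Sum>j\<in>J. a j (y j - x)) = (P x - (\<Sum>j\<in>J. a j x)) + (\<Sum>j\<in>J. a j (y j))"
proof -
  have "(\<Sum>j\<in>J. a j (y j - x)) = (\<Sum>j\<in>J. a j (y j) - a j x)"
    by (rule sum.cong[OF refl linear_diff[OF assms]])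
  then show ?thesis by (simp add: sum_subtractf)
qed

lemma linear_phi_sum:
  fixes S :: "real \<Rightarrow> 'a::banach \<Rightarrow>\<^sub>L 'a"
  assumes "c0_semigroup S" "0 \<le> t"
  shows "linear (\<lambda>x. \<Sum>k=1..l. g k *\<^sub>R phi S k t x)"
  by (rule linear_compose_sum, rule ballI, rule linear_compose_scale_right, rule linear_phi[OF assms])

text \<open>
  The point of the MERK construction: with its fast problem solved exactly, a MERK stage is an
  exponential Runge--Kutta stage, whatever values the previous stages have. So the solver errors are
  just residuals in the Runge--Kutta equations. The next lemma says the same of the step.
\<close>

lemma var_const_merk_p:
  fixes S :: "real \<Rightarrow> 'a::banach \<Rightarrow>\<^sub>L 'a"
  assumes c0: "c0_semigroup S" and H: "0 < H" and R: "exprk_method R"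
    and i: "i \<in> {2..stages R}" and V: "V 1 = v"
  shows "var_const S (merk_p N R H t v V i) v (node R i * H) =
    blinfun_apply (S (node R i * H)) v
    + H *\<^sub>R (\<Sum>j\<in>{1..<i}. exprk_a S R H i j (N (t + node R j * H) (V j)))"
proof -
  let ?a = "\<lambda>j x. \<Sum>k=1..alen R i j. alpha R i j k *\<^sub>R phi S k (node R i * H) x"
  let ?P = "\<lambda>x. node R i *\<^sub>R phi S 1 (node R i * H) x"
  let ?y = "\<lambda>j. N (t + node R j * H) (V j)"
  have ci: "0 < node R i" and c1: "node R 1 = 0" using R i by (auto simp: exprk_method_def)
  then have "0 \<le> node R i * H" using H by simp
  have y1: "?y 1 = N t v" using c1 V by simp
  have "var_const S (merk_p N R H t v V i) v (node R i * H) =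
      blinfun_apply (S (node R i * H)) v + H *\<^sub>R (?P (N t v) + (\<Sum>j=2..<i. ?a j (?y j - N t v)))"
    unfolding merk_p_def merk_D_def
    by (rule var_const_polynomial_forcing[OF c0 ci H]) simp
  also have "?P (N t v) + (\<Sum>j=2..<i. ?a j (?y j - N t v)) =
      (?P (N t v) - (\<Sum>j=2..<i. ?a j (N t v))) + (\<Sum>j=2..<i. ?a j (?y j))"
    by (rule weights_on_differences) (rule linear_phi_sum[OF c0 \<open>0 \<le> node R i * H\<close>])
  also have "\<dots> = exprk_a S R H i 1 (?y 1) + (\<Sum>j=2..<i. exprk_a S R H i j (?y j))"
    unfolding y1 by (simp add: exprk_a_def)
  also have "\<dots> = (\<Sum>j\<in>{1..<i}. exprk_a S R H i j (?y j))"
    using i by (subst (2) sum.atLeast_Suc_lessThan) (auto simp: numeral_2_eq_2)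
  finally show ?thesis .
qed

lemma var_const_merk_q:
  fixes S :: "real \<Rightarrow> 'a::banach \<Rightarrow>\<^sub>L 'a"
  assumes c0: "c0_semigroup S" and H: "0 < H" and R: "exprk_method R" and V: "V 1 = v"
  shows "var_const S (merk_q N R H t v V) v H =
    blinfun_apply (S H) v
    + H *\<^sub>R (\<Sum>i=1..stages R. exprk_b S R H i (N (t + node R i * H) (V i)))"
proof -
  let ?b = "\<lambda>i x. \<Sum>k=1..blen R i. beta R i k *\<^sub>R phi S k H x"
  let ?y = "\<lambda>i. N (t + node R i * H) (V i)"
  have s: "1 \<le> stages R" and c1: "node R 1 = 0" using R by (auto simp: exprk_method_def)
  have "0 \<le> H" using H by simp
  have y1: "?y 1 = N t v" using c1 V by simp
  have "var_const S (merk_q N R H t v V) v H =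
      blinfun_apply (S H) v + H *\<^sub>R (phi S 1 H (N t v) + (\<Sum>i=2..stages R. ?b i (?y i - N t v)))"
    using var_const_polynomial_forcing[OF c0 zero_less_one H, where J = "{2..stages R}" and x = "N t v" and l = "blen R"
        and g = "beta R" and d = "merk_D N R H t v V" and v = v]
    by (simp add: merk_q_def[abs_def] merk_D_def)
  also have "phi S 1 H (N t v) + (\<Sum>i=2..stages R. ?b i (?y i - N t v)) =
      (phi S 1 H (N t v) - (\<Sum>i=2..stages R. ?b i (N t v))) + (\<Sum>i=2..stages R. ?b i (?y i))"
    by (rule weights_on_differences) (rule linear_phi_sum[OF c0 \<open>0 \<le> H\<close>])
  also have "\<dots> = exprk_b S R H 1 (?y 1) + (\<Sum>i=2..stages R. exprk_b S R H i (?y i))"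
    unfolding y1 by (simp add: exprk_b_def)
  also have "\<dots> = (\<Sum>i=1..stages R. exprk_b S R H i (?y i))"
    using s by (subst (2) sum.atLeast_Suc_atMost) (auto simp: numeral_2_eq_2)
  finally show ?thesis .
qed

text \<open>
  \<open>exprk_a\<close> and \<open>exprk_b\<close> have a common shape, with \<open>c = c\<^sub>i\<close> and \<open>c = 1\<close> respectively, for which
  linearity and (\<open>norm_weights_le\<close>) bounds are proved once.
\<close>

lemma linear_weights:
  fixes S :: "real \<Rightarrow> 'a::banach \<Rightarrow>\<^sub>L 'a" and g :: "nat \<Rightarrow> nat \<Rightarrow> real" and l :: "nat \<Rightarrow> nat"
  assumes "c0_semigroup S" "0 \<le> t"
  defines "a \<equiv> \<lambda>j x. \<Sum>k=1..l j. g j k *\<^sub>R phi S k t x"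
  shows "linear (\<lambda>x. if j = 1 then c *\<^sub>R phi S 1 t x - (\<Sum>j\<in>J. a j x) else a j x)"
proof -
  have a: "linear (\<lambda>x. a j x)" for j
    unfolding a_def by (rule linear_phi_sum[OF assms(1,2)])
  have "linear (\<lambda>x. c *\<^sub>R phi S 1 t x - (\<Sum>j\<in>J. a j x))"
    by (rule linear_compose_sub[OF linear_compose_scale_right[OF linear_phi[OF assms(1,2)]]
          linear_compose_sum]) (rule ballI, rule a)
  with a[of j] show ?thesis
    by (cases "j = 1") simp_all
qed

lemma linear_exprk_a:
  fixes S :: "real \<Rightarrow> 'a::banach \<Rightarrow>\<^sub>L 'a"
  assumes "c0_semigroup S" "0 \<le> node R i * H"
  shows "linear (exprk_a S R H i j)"
  using linear_weights[OF assms, where j = j and c = "node R i" and J = "{2..<i}" and l = "alen R i" and g = "alpha R i"]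
  by (simp only: exprk_a_def[abs_def] Let_def)

lemma linear_exprk_b:
  fixes S :: "real \<Rightarrow> 'a::banach \<Rightarrow>\<^sub>L 'a"
  assumes "c0_semigroup S" "0 \<le> H"
  shows "linear (exprk_b S R H i)"
  using linear_weights[OF assms, where j = i and c = 1 and J = "{2..stages R}" and l = "blen R" and g = "beta R"]
  by (simp only: exprk_b_def[abs_def] Let_def scaleR_one)

lemma norm_phi_sum_le:
  fixes S :: "real \<Rightarrow> 'a::banach \<Rightarrow>\<^sub>L 'a"
  assumes "c0_semigroup S" "0 \<le> t" "\<And>s. 0 \<le> s \<Longrightarrow> s \<le> t \<Longrightarrow> norm (S s) \<le> M"
  shows "norm (\<Sum>k=1..l. g k *\<^sub>R phi S k t x) \<le> (\<Sum>k=1..l. \<bar>g k\<bar>) * (M * norm x)"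
proof -
  have "norm (g k *\<^sub>R phi S k t x) \<le> \<bar>g k\<bar> * (M * norm x)" for k
    unfolding norm_scaleR by (intro mult_left_mono norm_phi_le[OF assms]) auto
  then show ?thesis
    unfolding sum_distrib_right by (intro sum_norm_le)
qed

lemma norm_weights_le:
  fixes S :: "real \<Rightarrow> 'a::banach \<Rightarrow>\<^sub>L 'a" and g :: "nat \<Rightarrow> nat \<Rightarrow> real" and l :: "nat \<Rightarrow> nat"
  assumes "c0_semigroup S" "0 \<le> t" "\<And>s. 0 \<le> s \<Longrightarrow> s \<le> t \<Longrightarrow> norm (S s) \<le> M" and J: "finite J" and j: "j = 1 \<or> j \<in> J"
    and c: "0 \<le> c"
  defines "a \<equiv> \<lambda>j x. \<Sum>k=1..l j. g j k *\<^sub>R phi S k t x"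
  shows "norm (if j = 1 then c *\<^sub>R phi S 1 t x - (\<Sum>j\<in>J. a j x) else a j x)
    \<le> (c + (\<Sum>j\<in>J. \<Sum>k=1..l j. \<bar>g j k\<bar>)) * (M * norm x)"
proof -
  have M: "0 \<le> M * norm x"
    using assms(2) order_trans[OF norm_ge_zero assms(3)[of 0]] by simp
  have a: "norm (a j x) \<le> (\<Sum>k=1..l j. \<bar>g j k\<bar>) * (M * norm x)" for j
    unfolding a_def by (rule norm_phi_sum_le[OF assms(1-3)])
  show ?thesis
  proof (cases "j = 1")
    case True
    have "norm (c *\<^sub>R phi S 1 t x) \<le> c * (M * norm x)"
      using c norm_phi_le[OF assms(1-3), of 1 x] by (simp add: mult_left_mono)
    moreover have "norm (\<Sum>j\<in>J. a j x) \<le> (\<Sum>j\<in>J. \<Sum>k=1..l j. \<bar>g j k\<bar>) * (M * norm x)"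
      unfolding sum_distrib_right[of _ J] by (intro sum_norm_le a)
    ultimately show ?thesis
      using True norm_triangle_ineq4[of "c *\<^sub>R phi S 1 t x" "\<Sum>j\<in>J. a j x"] by (simp add: distrib_right)
  next
    case False
    then have "(\<Sum>k=1..l j. \<bar>g j k\<bar>) \<le> (\<Sum>j\<in>J. \<Sum>k=1..l j. \<bar>g j k\<bar>)"
      using j J by (intro member_le_sum) (auto intro: sum_nonneg)
    then have "(\<Sum>k=1..l j. \<bar>g j k\<bar>) * (M * norm x) \<le> (c + (\<Sum>j\<in>J. \<Sum>k=1..l j. \<bar>g j k\<bar>)) * (M * norm x)"
      using c M by (intro mult_right_mono) auto
    then show ?thesis using False a[of j] by simp
  qed
qed

lemma exprk_weights_bounded:
  fixes S :: "real \<Rightarrow> 'a::banach \<Rightarrow>\<^sub>L 'a"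
  assumes c0: "c0_semigroup S" and R: "exprk_method R"
    and M: "\<And>t. 0 \<le> t \<Longrightarrow> t \<le> 1 \<Longrightarrow> norm (S t) \<le> M"
  obtains B where "0 \<le> B"
    "\<And>H i j x. 0 < H \<Longrightarrow> H \<le> 1 \<Longrightarrow> i \<in> {1..stages R} \<Longrightarrow> j \<in> {1..<i} \<Longrightarrow> norm (exprk_a S R H i j x) \<le> B * norm x"
    "\<And>H i x. 0 < H \<Longrightarrow> H \<le> 1 \<Longrightarrow> i \<in> {1..stages R} \<Longrightarrow> norm (exprk_b S R H i x) \<le> B * norm x"
proof
  define A where "A i = node R i + (\<Sum>j=2..<i. \<Sum>k=1..alen R i j. \<bar>alpha R i j k\<bar>)" for i
  define A' where "A' = 1 + (\<Sum>i=2..stages R. \<Sum>k=1..blen R i. \<bar>beta R i k\<bar>)"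
  let ?B = "(A' + (\<Sum>i=2..stages R. A i)) * M"
  have M0: "0 \<le> M" using M[of 0] norm_ge_zero[of "S 0"] by linarith
  have A0: "0 \<le> A i" if "i \<in> {2..stages R}" for i
  proof -
    have "0 \<le> node R i" using R that by (auto simp: exprk_method_def intro: less_imp_le)
    then show ?thesis unfolding A_def by (intro add_nonneg_nonneg sum_nonneg) auto
  qed
  have A'0: "0 \<le> A'" by (auto simp: A'_def intro!: add_nonneg_nonneg sum_nonneg)
  show "0 \<le> ?B" using M0 A0 A'0 by (intro mult_nonneg_nonneg add_nonneg_nonneg sum_nonneg) auto
  fix H x assume H: "0 < H" "H \<le> (1::real)"
  show "norm (exprk_a S R H i j x) \<le> ?B * norm x" if i: "i \<in> {1..stages R}" and j: "j \<in> {1..<i}" for i j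
  proof -
    have i2: "i \<in> {2..stages R}" using i j by auto
    have ci: "0 < node R i" "node R i \<le> 1" using R i2 by (auto simp: exprk_method_def)
    then have t: "0 \<le> node R i * H" "node R i * H \<le> 1" using H by (auto intro: mult_le_one)
    have "norm (exprk_a S R H i j x) \<le> A i * (M * norm x)"
      unfolding exprk_a_def Let_def A_def
      by (rule norm_weights_le[OF c0 t(1)]) (use M t ci j in auto)
    also have "A i \<le> A' + (\<Sum>i=2..stages R. A i)"
      using member_le_sum[of i "{2..stages R}" A] i2 A0 A'0 by auto
    finally show ?thesis using M0 by (simp add: mult_right_mono mult.assoc)
  qed
  show "norm (exprk_b S R H i x) \<le> ?B * norm x" if i: "i \<in> {1..stages R}" for i
  proof -
    have "norm (exprk_b S R H i x) \<le> A' * (M * norm x)"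
      using norm_weights_le[OF c0, of H M "{2..stages R}" i 1, where l = "blen R" and g = "beta R" and x = x] M H i
      unfolding exprk_b_def Let_def A'_def by fastforce
    also have "A' \<le> A' + (\<Sum>i=2..stages R. A i)"
      using A0 by (auto intro: sum_nonneg)
    finally show ?thesis using M0 by (simp add: mult_right_mono mult.assoc)
  qed
qed

section \<open>Lipschitz continuity of the nonlinearity\<close>

lemma frechet_smooth_has_derivative:
  assumes f: "frechet_smooth K W f" and K: "1 \<le> K"
  obtains B f' where "0 \<le> B" "\<And>x. x \<in> W \<Longrightarrow> (f has_derivative f' x) (at x within W)"
    "\<And>x. x \<in> W \<Longrightarrow> onorm (f' x) \<le> B"
proof -
  from f show thesis unfolding frechet_smooth_def
  proof (elim exE conjE)
    fix F and B :: real assume F0: "\<forall>x\<in>W. F 0 x [] = f x"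
      and bnd: "\<forall>j\<in>{1..K}. \<forall>x\<in>W. multilinear j (F j x) \<and>
             (\<forall>vs. length vs = j \<longrightarrow> norm (F j x vs) \<le> B * prod_list (map norm vs))"
      and der: "\<forall>j<K. \<forall>x\<in>W. \<forall>\<epsilon>>0. \<exists>d>0. \<forall>y\<in>W. norm (y - x) < d \<longrightarrow>
             (\<forall>vs. length vs = j \<longrightarrow>
                norm (F j y vs - F j x vs - F (Suc j) x ((y - x) # vs))
                  \<le> \<epsilon> * norm (y - x) * prod_list (map norm vs))"
    have one: "1 \<in> {1..K}" using K by simp
    have bd: "norm (F 1 x [v]) \<le> \<bar>B\<bar> * norm v" if "x \<in> W" for x v
    proof -
      have "norm (F 1 x [v]) \<le> B * prod_list (map norm [v])"
        using bspec[OF bspec[OF bnd one] that] by (elim conjE allE[of _ "[v]"]) auto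
      then have "norm (F 1 x [v]) \<le> B * norm v" by simp
      also have "\<dots> \<le> \<bar>B\<bar> * norm v" by (intro mult_right_mono) auto
      finally show ?thesis .
    qed
    have lin: "bounded_linear (\<lambda>v. F 1 x [v])" if "x \<in> W" for x
    proof -
      have "multilinear 1 (F 1 x)" using bspec[OF bspec[OF bnd one] that] by simp
      then have "linear (\<lambda>v. F 1 x ([] @ v # []))" unfolding multilinear_def
        by (elim allE[of _ "[]"]) simp
      then have "linear (\<lambda>v. F 1 x [v])" by simp
      then show ?thesis
        by (rule bounded_linear.intro)
          (use bd[OF that] in \<open>auto simp: bounded_linear_axioms_def mult.commute intro!: exI[of _ "\<bar>B\<bar>"]\<close>)
    qed
    show thesis
    proof (rule that)
      show "0 \<le> \<bar>B\<bar>" by simp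
      fix x assume x: "x \<in> W"
      show "(f has_derivative (\<lambda>v. F 1 x [v])) (at x within W)"
        unfolding has_derivative_within_alt
      proof (intro conjI allI impI lin x)
        fix e :: real assume "0 < e"
        then have "\<exists>d>0. \<forall>y\<in>W. norm (y - x) < d \<longrightarrow>
             (\<forall>vs. length vs = 0 \<longrightarrow> norm (F 0 y vs - F 0 x vs - F (Suc 0) x ((y - x) # vs))
                  \<le> e * norm (y - x) * prod_list (map norm vs))"
          using der[rule_format, OF _ x, of 0 e] K by simp
        then obtain d where d: "d > 0" and *: "\<And>y. y \<in> W \<Longrightarrow> norm (y - x) < d \<Longrightarrow>
            norm (F 0 y [] - F 0 x [] - F (Suc 0) x [y - x]) \<le> e * norm (y - x)"
          by auto
        show "\<exists>d>0. \<forall>y\<in>W. norm (y - x) < d \<longrightarrow> norm (f y - f x - F 1 x [y - x]) \<le> e * norm (y - x)"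
          using d * x by (intro exI[of _ d]) (auto simp: F0)
      qed
      show "onorm (\<lambda>v. F 1 x [v]) \<le> \<bar>B\<bar>"
        by (rule onorm_bound) (use bd[OF x] in auto)
    qed
  qed
qed

text \<open>
  At fixed time the strip is a ball, which is convex; so the bound on the first derivative is a
  Lipschitz constant there.
\<close>

lemma smooth_along_lipschitz:
  assumes N: "smooth_along K t0 T u N" and K: "1 \<le> K" and u: "continuous_on {t0..T} u"
  obtains \<rho> \<Lambda> where "0 < \<rho>" "0 \<le> \<Lambda>"
    "\<And>t v v'. t \<in> {t0..T} \<Longrightarrow> norm (v - u t) \<le> \<rho> \<Longrightarrow> norm (v' - u t) \<le> \<rho> \<Longrightarrow>
       norm (N t v - N t v') \<le> \<Lambda> * norm (v - v')"
    "continuous_on {t0..T} (\<lambda>t. N t (u t))"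
proof -
  obtain \<rho> where \<rho>: "0 < \<rho>"
    and sm: "frechet_smooth K {(t, v). t \<in> {t0..T} \<and> norm (v - u t) \<le> \<rho>} (\<lambda>(t, v). N t v)"
    using N unfolding smooth_along_def by blast
  let ?W = "{(t, v). t \<in> {t0..T} \<and> norm (v - u t) \<le> \<rho>}" and ?f = "\<lambda>(t, v). N t v"
  obtain B f' where B: "0 \<le> B" and der: "\<And>x. x \<in> ?W \<Longrightarrow> (?f has_derivative f' x) (at x within ?W)"
    and on: "\<And>x. x \<in> ?W \<Longrightarrow> onorm (f' x) \<le> B"
    by (rule frechet_smooth_has_derivative[OF sm K]) (rule that)
  show ?thesis
  proof
    fix t v v' assume t: "t \<in> {t0..T}" and v: "norm (v - u t) \<le> \<rho>" "norm (v' - u t) \<le> \<rho>"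
    have sub: "{t} \<times> cball (u t) \<rho> \<subseteq> ?W"
      using t by (auto simp: dist_norm norm_minus_commute)
    have "norm (?f (t, v) - ?f (t, v')) \<le> B * norm ((t, v) - (t, v'))"
    proof (rule differentiable_bound[where S = "{t} \<times> cball (u t) \<rho>" and f' = f'])
      show "convex ({t} \<times> cball (u t) \<rho>)" by (intro convex_Times) auto
      show "(?f has_derivative f' x) (at x within {t} \<times> cball (u t) \<rho>)" if "x \<in> {t} \<times> cball (u t) \<rho>" for x
        by (rule has_derivative_subset[OF der sub]) (use that sub in blast)
      show "onorm (f' x) \<le> B" if "x \<in> {t} \<times> cball (u t) \<rho>" for x
        by (rule on) (use that sub in blast)
    qed (use v in \<open>auto simp: dist_norm norm_minus_commute\<close>)
    then show "norm (N t v - N t v') \<le> B * norm (v - v')"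
      by (simp add: norm_Pair)
  next
    have "continuous_on ?W ?f"
      using der by (meson continuous_on_eq_continuous_within has_derivative_continuous)
    moreover have "continuous_on {t0..T} (\<lambda>t. (t, u t))"
      by (intro continuous_intros u)
    ultimately have "continuous_on {t0..T} (\<lambda>t. ?f (t, u t))"
      by (rule continuous_on_compose2) (use \<rho> in auto)
    then show "continuous_on {t0..T} (\<lambda>t. N t (u t))" by simp
  qed (use \<rho> B in auto)
qed

section \<open>Discrete inequalities\<close>

text \<open>
  The inequality for \<open>a n\<close> is only required to hold if the earlier terms satisfy the asserted bound.
  This allows the inequality to depend on the earlier values still lying where the nonlinearity is
  Lipschitz.
\<close>

lemma discrete_gronwall:
  fixes a :: "nat \<Rightarrow> real"
  assumes \<alpha>: "0 \<le> \<alpha>" and \<beta>: "0 \<le> \<beta>"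
    and step: "\<And>n. l \<le> n \<Longrightarrow> n \<le> m \<Longrightarrow> (\<And>k. l \<le> k \<Longrightarrow> k < n \<Longrightarrow> a k \<le> \<alpha> * (1 + \<beta>) ^ k)
       \<Longrightarrow> a n \<le> \<alpha> + \<beta> * (\<Sum>k\<in>{l..<n}. a k)"
    and "l \<le> n" "n \<le> m"
  shows "a n \<le> \<alpha> * (1 + \<beta>) ^ n"
  using \<open>l \<le> n\<close> \<open>n \<le> m\<close>
proof (induction n rule: less_induct)
  case (less n)
  have IH: "a k \<le> \<alpha> * (1 + \<beta>) ^ k" if "l \<le> k" "k < n" for k
    using less that by simp
  have "(\<Sum>k\<in>{l..<n}. a k) \<le> (\<Sum>k\<in>{l..<n}. \<alpha> * (1 + \<beta>) ^ k)"
    by (intro sum_mono IH) auto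
  also have "\<dots> \<le> (\<Sum>k<n. \<alpha> * (1 + \<beta>) ^ k)"
    by (intro sum_mono2) (use \<alpha> \<beta> in auto)
  finally have "\<beta> * (\<Sum>k\<in>{l..<n}. a k) \<le> \<beta> * (\<Sum>k<n. \<alpha> * (1 + \<beta>) ^ k)"
    using \<beta> by (rule mult_left_mono)
  also have "\<dots> = \<alpha> * ((1 + \<beta>) ^ n - 1)"
    using power_diff_1_eq[of "1 + \<beta>" n] by (simp add: sum_distrib_left[symmetric] mult_ac)
  finally have "\<alpha> + \<beta> * (\<Sum>k\<in>{l..<n}. a k) \<le> \<alpha> * (1 + \<beta>) ^ n"
    by (simp add: algebra_simps)
  with step[OF less.prems IH] show ?case by linarith
qed

text \<open>
  The recursion is solved before norms are taken: powers of \<open>S H\<close> are themselves operators of the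
  semigroup and bounded by \<open>M\<close>, whereas estimating step by step would produce powers of \<open>M\<close>, too
  large if \<open>M > 1\<close>.
\<close>

lemma semigroup_recursion_bound:
  fixes S :: "real \<Rightarrow> 'a::banach \<Rightarrow>\<^sub>L 'a" and e d :: "nat \<Rightarrow> 'a"
  assumes c0: "c0_semigroup S" and H: "0 \<le> H" and e0: "e 0 = 0"
    and rec: "\<And>k. k < n \<Longrightarrow> e (Suc k) = blinfun_apply (S H) (e k) + d k"
    and M: "\<And>t. 0 \<le> t \<Longrightarrow> t \<le> real n * H \<Longrightarrow> norm (S t) \<le> M"
  shows "norm (e n) \<le> M * (\<Sum>k<n. norm (d k))"
proof -
  have semi: "S (s + t) = S s o\<^sub>L S t" if "0 \<le> s" "0 \<le> t" for s t
    using c0 that by (auto simp: c0_semigroup_def)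
  have "e m = (\<Sum>k<m. blinfun_apply (S (real (m - Suc k) * H)) (d k))" if "m \<le> n" for m
    using that
  proof (induction m)
    case (Suc m)
    have "blinfun_apply (S H) (e m) = (\<Sum>k<m. blinfun_apply (S (real (Suc m - Suc k) * H)) (d k))"
    proof -
      have "blinfun_apply (S H) (blinfun_apply (S (real (m - Suc k) * H)) x)
          = blinfun_apply (S (real (Suc m - Suc k) * H)) x" if "k < m" for k x
      proof -
        have "real (Suc m - Suc k) * H = H + real (m - Suc k) * H"
          using that by (simp add: Suc_diff_Suc[symmetric] algebra_simps)
        then show ?thesis using semi[of H "real (m - Suc k) * H"] H by simp
      qed
      then show ?thesis using Suc by (simp add: blinfun.sum_right)
    qed
    moreover have "S 0 = id_blinfun" using c0 by (simp add: c0_semigroup_def)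
    ultimately show ?case using rec[of m] Suc.prems by simp
  qed (use e0 in simp)
  then have "norm (e n) = norm (\<Sum>k<n. blinfun_apply (S (real (n - Suc k) * H)) (d k))" by simp
  also have "\<dots> \<le> (\<Sum>k<n. M * norm (d k))"
    by (intro sum_norm_le order_trans[OF norm_blinfun] mult_right_mono M) (use H in \<open>auto intro: mult_right_mono\<close>)
  finally show ?thesis by (simp add: sum_distrib_left)
qed

section \<open>Stability of one step\<close>

text \<open>
  \<open>M\<close> bounds the semigroup on every time interval that occurs, \<open>B\<close> the coefficient operators for all
  step sizes up to \<open>1\<close>, and \<open>\<Lambda>\<close> is a Lipschitz constant of the nonlinearity in the strip of radius
  \<open>\<rho>\<close> along the solution.
\<close>

locale exprk_stability =
  fixes S :: "real \<Rightarrow> 'a::banach \<Rightarrow>\<^sub>L 'a" and N :: "real \<Rightarrow> 'a \<Rightarrow> 'a"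
    and t0 T :: real and u :: "real \<Rightarrow> 'a" and R :: exprk and M B \<Lambda> \<rho> :: real
  assumes c0: "c0_semigroup S" and R: "exprk_method R" and t0_less_T: "t0 < T"
    and M_ge_1: "1 \<le> M" and S_bound: "\<And>t. 0 \<le> t \<Longrightarrow> t \<le> max 1 (T - t0) \<Longrightarrow> norm (S t) \<le> M"
    and B_nonneg: "0 \<le> B"
    and a_bound: "\<And>H i j x. 0 < H \<Longrightarrow> H \<le> 1 \<Longrightarrow> i \<in> {1..stages R} \<Longrightarrow> j \<in> {1..<i} \<Longrightarrow>
        norm (exprk_a S R H i j x) \<le> B * norm x"
    and b_bound: "\<And>H i x. 0 < H \<Longrightarrow> H \<le> 1 \<Longrightarrow> i \<in> {1..stages R} \<Longrightarrow>
        norm (exprk_b S R H i x) \<le> B * norm x"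
    and \<Lambda>_nonneg: "0 \<le> \<Lambda>" and \<rho>_pos: "0 < \<rho>"
    and lipschitz: "\<And>t v v'. t \<in> {t0..T} \<Longrightarrow> norm (v - u t) \<le> \<rho> \<Longrightarrow> norm (v' - u t) \<le> \<rho> \<Longrightarrow>
        norm (N t v - N t v') \<le> \<Lambda> * norm (v - v')"
    and u_continuous: "continuous_on {t0..T} u"
    and N_continuous: "continuous_on {t0..T} (\<lambda>t. N t (u t))"
begin

lemma node_bounds:
  assumes "i \<in> {1..stages R}"
  shows "0 \<le> node R i" "node R i \<le> 1"
proof -
  have "0 \<le> node R i \<and> node R i \<le> 1"
  proof (cases "i = 1")
    case False
    then have "i \<in> {2..stages R}" using assms by auto
    then show ?thesis using R by (auto simp: exprk_method_def intro: less_imp_le)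
  qed (use R in \<open>simp add: exprk_method_def\<close>)
  then show "0 \<le> node R i" "node R i \<le> 1" by auto
qed

lemma stage_time:
  assumes "i \<in> {1..stages R}" "0 < H" "H \<le> 1"
  shows "0 \<le> node R i * H" "node R i * H \<le> H" "node R i * H \<le> 1"
    "t0 \<le> t \<Longrightarrow> t + H \<le> T \<Longrightarrow> t + node R i * H \<in> {t0..T}"
proof -
  show 0: "0 \<le> node R i * H" using node_bounds[OF assms(1)] assms by simp
  show 1: "node R i * H \<le> H" using node_bounds[OF assms(1)] assms by (simp add: mult_left_le_one_le)
  show "node R i * H \<le> 1" using 1 assms by linarith
  show "t + node R i * H \<in> {t0..T}" if "t0 \<le> t" "t + H \<le> T" using 0 1 that by simp
qed

text \<open>
  The stages of the method started on the exact solution stay close to it, as \<open>S \<tau> (u t)\<close> differs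
  little from \<open>u t\<close>, uniformly in \<open>t\<close>, and the other terms have a factor \<open>H\<close>. Half the radius of the
  strip is left for the perturbed stages.
\<close>

lemma exact_stages_near_solution:
  obtains H0 where "0 < H0" "H0 \<le> 1"
    "\<And>H t i. 0 < H \<Longrightarrow> H \<le> H0 \<Longrightarrow> t0 \<le> t \<Longrightarrow> t + H \<le> T \<Longrightarrow> i \<in> {1..stages R} \<Longrightarrow>
       norm (exprk_stage S N R H t (u t) i - u (t + node R i * H)) \<le> \<rho> / 2"
proof -
  have "bounded ((\<lambda>t. N t (u t)) ` {t0..T})"
    by (intro compact_imp_bounded compact_continuous_image N_continuous) auto
  then obtain G where G: "0 < G" "\<And>t. t \<in> {t0..T} \<Longrightarrow> norm (N t (u t)) \<le> G"
    unfolding bounded_pos by auto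
  have \<rho>8: "0 < \<rho> / 8" using \<rho>_pos by simp
  have "compact (u ` {t0..T})"
    by (intro compact_continuous_image u_continuous) auto
  from c0_semigroup_uniform_at_zero[OF c0 this \<rho>8]
  obtain d1 where d1: "0 < d1" "\<And>\<tau> x. 0 \<le> \<tau> \<Longrightarrow> \<tau> \<le> d1 \<Longrightarrow> x \<in> u ` {t0..T} \<Longrightarrow>
      norm (blinfun_apply (S \<tau>) x - x) < \<rho> / 8" by blast
  have "uniformly_continuous_on {t0..T} u"
    by (intro compact_uniformly_continuous u_continuous) auto
  then obtain d2 where d2: "0 < d2" "\<And>t t'. t \<in> {t0..T} \<Longrightarrow> t' \<in> {t0..T} \<Longrightarrow> dist t' t < d2 \<Longrightarrow>
      dist (u t') (u t) < \<rho> / 8"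
    unfolding uniformly_continuous_on_def using \<rho>8 by meson
  define Q where "Q = real (stages R) * (B * (G + \<Lambda> * \<rho>))"
  have Q: "0 \<le> Q" unfolding Q_def using B_nonneg G \<Lambda>_nonneg \<rho>_pos by simp
  show ?thesis
  proof
    \<comment> \<open>For these step sizes each of the terms \<open>S (c\<^sub>i H) (u t) - u t\<close>, \<open>u t - u (t + c\<^sub>i H)\<close> and
      \<open>H \<Sum>\<^sub>j a\<^sub>i\<^sub>j N\<close> is at most \<open>\<rho> / 8\<close>, where \<open>Q\<close> bounds the last sum.\<close>
    let ?H0 = "min (min 1 d1) (min (d2 / 2) (\<rho> / (8 * (Q + 1))))"
    show "0 < ?H0" "?H0 \<le> 1" using d1 d2 \<rho>_pos Q by auto
    fix H t i assume H: "0 < H" "H \<le> ?H0" and t: "t0 \<le> t" "t + H \<le> T" and i: "i \<in> {1..stages R}"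
    have Hd: "H \<le> d1" "H \<le> d2 / 2" using H by auto
    have H1: "H \<le> 1" and t': "t \<in> {t0..T}" using H t by auto
    show "norm (exprk_stage S N R H t (u t) i - u (t + node R i * H)) \<le> \<rho> / 2"
      using i
    proof (induction i rule: less_induct)
      case (less i)
      let ?U = "exprk_stage S N R H t (u t)"
      note ti = stage_time[OF less.prems H(1) H1]
      have "norm (exprk_a S R H i j (N (t + node R j * H) (?U j))) \<le> B * (G + \<Lambda> * \<rho>)" if j: "j \<in> {1..<i}" for j
      proof -
        have js: "j \<in> {1..stages R}" using j less.prems by auto
        note tj = stage_time(4)[OF js H(1) H1 t]
        have near: "norm (?U j - u (t + node R j * H)) \<le> \<rho>"
          using less.IH[of j] j js \<rho>_pos by simp
        have "norm (N (t + node R j * H) (?U j)) \<le>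
            norm (N (t + node R j * H) (u (t + node R j * H)))
            + norm (N (t + node R j * H) (?U j) - N (t + node R j * H) (u (t + node R j * H)))"
          by (rule norm_triangle_sub)
        also have "norm (N (t + node R j * H) (?U j) - N (t + node R j * H) (u (t + node R j * H)))
            \<le> \<Lambda> * norm (?U j - u (t + node R j * H))"
          using near \<rho>_pos by (intro lipschitz tj) auto
        also have "\<dots> \<le> \<Lambda> * \<rho>" using near \<Lambda>_nonneg by (rule mult_left_mono)
        finally have "norm (N (t + node R j * H) (?U j)) \<le> G + \<Lambda> * \<rho>"
          using G(2)[OF tj] by simp
        then show ?thesis
          using B_nonneg by (intro order_trans[OF a_bound[OF H(1) H1 less.prems j]] mult_left_mono)
      qed
      then have "norm (\<Sum>j\<in>{1..<i}. exprk_a S R H i j (N (t + node R j * H) (?U j))) \<le> (\<Sum>j\<in>{1..<i}. B * (G + \<Lambda> * \<rho>))"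
        by (rule sum_norm_le)
      also have "\<dots> \<le> Q"
      proof -
        have "real (i - 1) \<le> real (stages R)" using less.prems by auto
        then have "real (i - 1) * (B * (G + \<Lambda> * \<rho>)) \<le> Q"
          unfolding Q_def using B_nonneg G \<Lambda>_nonneg \<rho>_pos by (intro mult_right_mono) auto
        then show ?thesis by simp
      qed
      finally have "norm (H *\<^sub>R (\<Sum>j\<in>{1..<i}. exprk_a S R H i j (N (t + node R j * H) (?U j)))) \<le> H * Q"
        using H by (simp add: mult_left_mono)
      also have "\<dots> \<le> \<rho> / (8 * (Q + 1)) * Q" using H Q by (intro mult_right_mono) auto
      also have "\<dots> \<le> \<rho> / 8" using Q \<rho>_pos by (simp add: field_simps)
      finally have 3: "norm (H *\<^sub>R (\<Sum>j\<in>{1..<i}. exprk_a S R H i j (N (t + node R j * H) (?U j)))) \<le> \<rho> / 8" .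
      have 1: "norm (blinfun_apply (S (node R i * H)) (u t) - u t) < \<rho> / 8"
        using d1(2)[OF ti(1) _ imageI[OF t']] ti(2) Hd by linarith
      have 2: "norm (u t - u (t + node R i * H)) < \<rho> / 8"
        using d2(2)[OF ti(4)[OF t] t'] ti(1,2) Hd d2(1) by (simp add: dist_norm)
      have "?U i - u (t + node R i * H) = ((blinfun_apply (S (node R i * H)) (u t) - u t)
          + (u t - u (t + node R i * H)))
          + H *\<^sub>R (\<Sum>j\<in>{1..<i}. exprk_a S R H i j (N (t + node R j * H) (?U j)))"
        by (subst exprk_stage.simps) simp
      also have "norm \<dots> \<le> (\<rho> / 8 + \<rho> / 8) + \<rho> / 8"
        using 1 2 3 by (intro norm_triangle_le add_mono) auto
      also have "\<dots> \<le> \<rho> / 2" using \<rho>_pos by simp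
      finally show ?case .
    qed
  qed
qed

text \<open>
  \<open>\<kappa>\<close> is the Gronwall factor over the stages; \<open>\<Gamma>\<close> bounds the resulting change in the increment of a
  step, divided by \<open>H\<close>.
\<close>

definition \<kappa> :: real where "\<kappa> = M * (1 + B * \<Lambda>) ^ stages R"

definition \<Gamma> :: real where "\<Gamma> = real (stages R) * (B * (\<Lambda> * \<kappa>))"

lemma \<kappa>_nonneg: "0 \<le> \<kappa>" and \<Gamma>_nonneg: "0 \<le> \<Gamma>"
  using M_ge_1 B_nonneg \<Lambda>_nonneg by (auto simp: \<kappa>_def \<Gamma>_def)

text \<open>
  A perturbed step of size \<open>H\<close>: it starts from \<open>v\<close> instead of \<open>u t\<close>, and its stages \<open>V\<close> satisfy the
  stage equations up to \<open>\<epsilon>\<close>. The last assumption keeps the perturbed stages in the strip.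
\<close>

context
  fixes H t \<epsilon> :: real and v :: 'a and V :: "nat \<Rightarrow> 'a"
  assumes H: "0 < H" "H \<le> 1" and t: "t0 \<le> t" "t + H \<le> T" and \<epsilon>: "0 \<le> \<epsilon>"
    and exact: "\<And>i. i \<in> {1..stages R} \<Longrightarrow>
        norm (exprk_stage S N R H t (u t) i - u (t + node R i * H)) \<le> \<rho> / 2"
    and residual: "\<And>i. i \<in> {1..stages R} \<Longrightarrow> norm (V i - (blinfun_apply (S (node R i * H)) v
        + H *\<^sub>R (\<Sum>j\<in>{1..<i}. exprk_a S R H i j (N (t + node R j * H) (V j))))) \<le> \<epsilon>"
    and small: "\<kappa> * (norm (v - u t) + \<epsilon>) \<le> \<rho> / 2"
begin

lemma nonlinearity_difference:
  assumes j: "j \<in> {1..stages R}"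
    and V: "norm (V j - exprk_stage S N R H t (u t) j) \<le> \<kappa> * (norm (v - u t) + \<epsilon>)"
  shows "norm (N (t + node R j * H) (V j) - N (t + node R j * H) (exprk_stage S N R H t (u t) j))
    \<le> \<Lambda> * norm (V j - exprk_stage S N R H t (u t) j)"
proof (rule lipschitz[OF stage_time(4)[OF j H t]])
  let ?U = "exprk_stage S N R H t (u t) j"
  show "norm (?U - u (t + node R j * H)) \<le> \<rho>" using exact[OF j] \<rho>_pos by simp
  have "norm (V j - u (t + node R j * H)) \<le> norm (V j - ?U) + norm (?U - u (t + node R j * H))"
    using norm_triangle_ineq[of "V j - ?U" "?U - u (t + node R j * H)"] by simp
  then show "norm (V j - u (t + node R j * H)) \<le> \<rho>" using V small exact[OF j] by simp
qed

lemma stages_stable: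
  assumes i: "i \<in> {1..stages R}"
  shows "norm (V i - exprk_stage S N R H t (u t) i) \<le> \<kappa> * (norm (v - u t) + \<epsilon>)"
proof -
  let ?U = "exprk_stage S N R H t (u t)" and ?X = "norm (v - u t) + \<epsilon>"
  have \<beta>: "0 \<le> B * \<Lambda>" using B_nonneg \<Lambda>_nonneg by simp
  have \<alpha>: "0 \<le> M * ?X" using M_ge_1 \<epsilon> by simp
  have \<kappa>: "M * ?X * (1 + B * \<Lambda>) ^ j \<le> \<kappa> * ?X" if "j \<le> stages R" for j
  proof -
    have "(1 + B * \<Lambda>) ^ j \<le> (1 + B * \<Lambda>) ^ stages R" using \<beta> that by (intro power_increasing) auto
    then have "M * ?X * (1 + B * \<Lambda>) ^ j \<le> M * ?X * (1 + B * \<Lambda>) ^ stages R" using \<alpha> by (rule mult_left_mono)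
    then show ?thesis by (simp add: \<kappa>_def mult_ac)
  qed
  have "norm (V i - ?U i) \<le> M * ?X * (1 + B * \<Lambda>) ^ i"
  proof (rule discrete_gronwall[where a = "\<lambda>i. norm (V i - ?U i)" and l = 1 and m = "stages R", OF \<alpha> \<beta>])
    fix n assume n: "1 \<le> n" "n \<le> stages R"
      and IH: "\<And>k. 1 \<le> k \<Longrightarrow> k < n \<Longrightarrow> norm (V k - ?U k) \<le> M * ?X * (1 + B * \<Lambda>) ^ k"
    have ns: "n \<in> {1..stages R}" using n by simp
    note tn = stage_time[OF ns H]
    let ?a = "exprk_a S R H n" and ?NV = "\<lambda>j. N (t + node R j * H) (V j)" and ?NU = "\<lambda>j. N (t + node R j * H) (?U j)"
    define r where "r = V n - (blinfun_apply (S (node R n * H)) v + H *\<^sub>R (\<Sum>j\<in>{1..<n}. ?a j (?NV j)))"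
    have r: "norm r \<le> \<epsilon>" unfolding r_def by (rule residual[OF ns])
    have "norm (?a j (?NV j - ?NU j)) \<le> B * \<Lambda> * norm (V j - ?U j)" if j: "j \<in> {1..<n}" for j
    proof -
      have js: "j \<in> {1..stages R}" using j n by auto
      have "norm (?NV j - ?NU j) \<le> \<Lambda> * norm (V j - ?U j)"
        using IH[of j] \<kappa>[of j] j js by (intro nonlinearity_difference) auto
      then have "B * norm (?NV j - ?NU j) \<le> B * (\<Lambda> * norm (V j - ?U j))"
        using B_nonneg by (rule mult_left_mono)
      then show ?thesis using a_bound[OF H ns j, of "?NV j - ?NU j"] by (simp add: mult.assoc)
    qed
    then have "norm (\<Sum>j\<in>{1..<n}. ?a j (?NV j - ?NU j)) \<le> (\<Sum>j\<in>{1..<n}. B * \<Lambda> * norm (V j - ?U j))"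
      by (rule sum_norm_le)
    then have "H * norm (\<Sum>j\<in>{1..<n}. ?a j (?NV j - ?NU j)) \<le> 1 * (\<Sum>j\<in>{1..<n}. B * \<Lambda> * norm (V j - ?U j))"
      using H by (intro mult_mono) auto
    then have 3: "norm (H *\<^sub>R (\<Sum>j\<in>{1..<n}. ?a j (?NV j - ?NU j))) \<le> B * \<Lambda> * (\<Sum>j\<in>{1..<n}. norm (V j - ?U j))"
      using H by (simp add: sum_distrib_left)
    have 1: "norm r \<le> M * \<epsilon>"
      using r mult_right_mono[OF M_ge_1 \<epsilon>] by simp
    have 2: "norm (blinfun_apply (S (node R n * H)) (v - u t)) \<le> M * norm (v - u t)"
      using tn by (intro order_trans[OF norm_blinfun] mult_right_mono S_bound) auto
    have lin: "(\<Sum>j\<in>{1..<n}. ?a j (?NV j - ?NU j)) = (\<Sum>j\<in>{1..<n}. ?a j (?NV j)) - (\<Sum>j\<in>{1..<n}. ?a j (?NU j))"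
      unfolding sum_subtractf[symmetric]
      by (rule sum.cong[OF refl linear_diff[OF linear_exprk_a[OF c0 tn(1)]]])
    have "V n - ?U n = (r + blinfun_apply (S (node R n * H)) (v - u t))
        + H *\<^sub>R (\<Sum>j\<in>{1..<n}. ?a j (?NV j - ?NU j))"
      unfolding lin by (subst exprk_stage.simps) (simp add: r_def blinfun.diff_right scaleR_diff_right)
    also have "norm \<dots> \<le> (M * \<epsilon> + M * norm (v - u t)) + B * \<Lambda> * (\<Sum>j\<in>{1..<n}. norm (V j - ?U j))"
      using 1 2 3 by (intro norm_triangle_le add_mono) auto
    finally show "norm (V n - ?U n) \<le> M * ?X + B * \<Lambda> * (\<Sum>j\<in>{1..<n}. norm (V j - ?U j))"
      by (simp add: algebra_simps)
  qed (use i in auto)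
  also have "\<dots> \<le> \<kappa> * ?X" using i by (intro \<kappa>) auto
  finally show ?thesis .
qed

text \<open>
  The part \<open>S H (v - u t)\<close> of the propagated error is split off: over many steps it must not be
  estimated by its norm.
\<close>

lemma step_stable:
  "norm (blinfun_apply (S H) v + H *\<^sub>R (\<Sum>i=1..stages R. exprk_b S R H i (N (t + node R i * H) (V i)))
     - exprk_step S N R H t (u t) - blinfun_apply (S H) (v - u t)) \<le> H * (\<Gamma> * (norm (v - u t) + \<epsilon>))"
proof -
  let ?U = "exprk_stage S N R H t (u t)" and ?X = "norm (v - u t) + \<epsilon>"
  let ?NV = "\<lambda>j. N (t + node R j * H) (V j)" and ?NU = "\<lambda>j. N (t + node R j * H) (?U j)"
  have "norm (exprk_b S R H i (?NV i - ?NU i)) \<le> B * (\<Lambda> * (\<kappa> * ?X))" if i: "i \<in> {1..stages R}" for i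
  proof -
    have "norm (?NV i - ?NU i) \<le> \<Lambda> * norm (V i - ?U i)"
      by (rule nonlinearity_difference[OF i stages_stable[OF i]])
    also have "\<dots> \<le> \<Lambda> * (\<kappa> * ?X)" using stages_stable[OF i] \<Lambda>_nonneg by (rule mult_left_mono)
    finally show ?thesis
      using B_nonneg by (intro order_trans[OF b_bound[OF H i]] mult_left_mono)
  qed
  then have "norm (\<Sum>i=1..stages R. exprk_b S R H i (?NV i - ?NU i)) \<le> (\<Sum>i=1..stages R. B * (\<Lambda> * (\<kappa> * ?X)))"
    by (rule sum_norm_le)
  also have "\<dots> = \<Gamma> * ?X" by (simp add: \<Gamma>_def)
  finally have bound: "norm (H *\<^sub>R (\<Sum>i=1..stages R. exprk_b S R H i (?NV i - ?NU i))) \<le> H * (\<Gamma> * ?X)"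
    using H by (simp add: mult_left_mono)
  have lin: "(\<Sum>i=1..stages R. exprk_b S R H i (?NV i - ?NU i))
      = (\<Sum>i=1..stages R. exprk_b S R H i (?NV i)) - (\<Sum>i=1..stages R. exprk_b S R H i (?NU i))"
    unfolding sum_subtractf[symmetric]
    by (rule sum.cong[OF refl linear_diff[OF linear_exprk_b[OF c0]]]) (use H in simp)
  have split: "blinfun_apply (S H) v + H *\<^sub>R (\<Sum>i=1..stages R. exprk_b S R H i (?NV i))
      - exprk_step S N R H t (u t) - blinfun_apply (S H) (v - u t)
      = H *\<^sub>R (\<Sum>i=1..stages R. exprk_b S R H i (?NV i - ?NU i))"
    unfolding lin by (simp add: exprk_step_def blinfun.diff_right scaleR_diff_right)
  show ?thesis unfolding split by (rule bound)
qed

end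

end

section \<open>Error accumulation\<close>

context exprk_stability
begin

text \<open>
  Insert between the new value and the exact solution the step with exact solution of the last fast
  problem, and the base method applied to the exact solution. The three differences are the error of
  the step solver, the effect of the present error and of the stage errors, and the local error. The
  stage errors enter only through the nonlinearity and so gain the factor \<open>H\<close> of the increment: this
  is where the bound gets \<open>H h\<^sup>q\<close> for the stages but \<open>h\<^sup>r\<close> for the step.
\<close>

lemma merk_defect:
  assumes H: "0 < H" "H \<le> 1" and t: "t0 \<le> t" "t + H \<le> T"
    and exact: "\<And>i. i \<in> {1..stages R} \<Longrightarrow>
        norm (exprk_stage S N R H t (u t) i - u (t + node R i * H)) \<le> \<rho> / 2"
    and local: "norm (exprk_step S N R H t (u t) - u (t + H)) \<le> H * A"
    and V1: "V 1 = v" and \<epsilon>: "0 \<le> \<epsilon>"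
    and V: "\<And>i. i \<in> {2..stages R} \<Longrightarrow>
        norm (V i - var_const S (merk_p N R H t v V i) v (node R i * H)) \<le> \<epsilon>"
    and v': "norm (v' - var_const S (merk_q N R H t v V) v H) \<le> H * \<delta>"
    and small: "\<kappa> * (norm (v - u t) + \<epsilon>) \<le> \<rho> / 2"
  shows "norm ((v' - u (t + H)) - blinfun_apply (S H) (v - u t))
    \<le> H * (\<Gamma> * norm (v - u t) + (A + \<Gamma> * \<epsilon> + \<delta>))"
proof -
  have residual: "norm (V i - (blinfun_apply (S (node R i * H)) v
      + H *\<^sub>R (\<Sum>j\<in>{1..<i}. exprk_a S R H i j (N (t + node R j * H) (V j))))) \<le> \<epsilon>"
    if i: "i \<in> {1..stages R}" for i
  proof (cases "i = 1")
    case True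
    then show ?thesis using V1 R c0 \<epsilon> by (simp add: exprk_method_def c0_semigroup_def)
  next
    case False
    then have i2: "i \<in> {2..stages R}" using i by auto
    show ?thesis using V[OF i2] unfolding var_const_merk_p[where V = V and v = v, OF c0 H(1) R i2 V1] .
  qed
  let ?E = "blinfun_apply (S H) v + H *\<^sub>R (\<Sum>i=1..stages R. exprk_b S R H i (N (t + node R i * H) (V i)))"
  have 1: "norm (v' - ?E) \<le> H * \<delta>"
    using v' unfolding var_const_merk_q[where V = V and v = v, OF c0 H(1) R V1] .
  have 2: "norm (?E - exprk_step S N R H t (u t) - blinfun_apply (S H) (v - u t)) \<le> H * (\<Gamma> * (norm (v - u t) + \<epsilon>))"
    by (rule step_stable[OF H t \<epsilon> exact residual small])
  have "(v' - u (t + H)) - blinfun_apply (S H) (v - u t) = (v' - ?E)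
      + (?E - exprk_step S N R H t (u t) - blinfun_apply (S H) (v - u t))
      + (exprk_step S N R H t (u t) - u (t + H))" by simp
  also have "norm \<dots> \<le> H * \<delta> + H * (\<Gamma> * (norm (v - u t) + \<epsilon>)) + H * A"
    by (intro norm_triangle_le add_mono 1 2 local)
  finally show ?thesis by (simp add: algebra_simps)
qed

text \<open>
  The Gronwall factor over all steps. It involves the semigroup, the method and the nonlinearity, but
  no error constant.
\<close>

definition amplification :: real where
  "amplification = M * (T - t0) * exp (M * \<Gamma> * (T - t0))"

lemma amplification_nonneg: "0 \<le> amplification"
  using M_ge_1 t0_less_T by (simp add: amplification_def)

text \<open>
  The errors of the steps accumulate over \<open>n \<le> (T - t0) / H\<close> steps, which costs the factor \<open>H\<close> of
  the defect. The discrete Gronwall inequality supplies, along with the bound, the smallness of the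
  error that the Lipschitz estimate of the next step presupposes.
\<close>

lemma merk_error_bound:
  assumes H: "0 < H" "H \<le> 1" and n: "t0 + real n * H \<le> T"
    and exact: "\<And>t i. t0 \<le> t \<Longrightarrow> t + H \<le> T \<Longrightarrow> i \<in> {1..stages R} \<Longrightarrow>
        norm (exprk_stage S N R H t (u t) i - u (t + node R i * H)) \<le> \<rho> / 2"
    and local: "\<And>k. t0 + real (Suc k) * H \<le> T \<Longrightarrow>
        norm (exprk_step S N R H (t0 + real k * H) (u (t0 + real k * H)) - u (t0 + real (Suc k) * H)) \<le> H * A"
    and run: "merk_run S N t0 T (u t0) R q r c2 c3 H h w W"
    and nonneg: "0 \<le> A" "0 \<le> c2" "0 \<le> c3" "0 \<le> h"
    and small: "\<kappa> * (amplification * (A + \<Gamma> * (c2 * H * h ^ q) + c3 * h ^ r) + c2 * H * h ^ q) \<le> \<rho> / 2"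
  shows "norm (w n - u (t0 + real n * H)) \<le> amplification * (A + \<Gamma> * (c2 * H * h ^ q) + c3 * h ^ r)"
proof -
  define e where "e k = w k - u (t0 + real k * H)" for k
  define \<eta> where "\<eta> = A + \<Gamma> * (c2 * H * h ^ q) + c3 * h ^ r"
  have \<eta>: "0 \<le> \<eta>" unfolding \<eta>_def using nonneg H \<Gamma>_nonneg by simp
  let ?\<alpha> = "M * (T - t0) * \<eta>" and ?\<beta> = "M * \<Gamma> * H"
  have \<alpha>: "0 \<le> ?\<alpha>" and \<beta>: "0 \<le> ?\<beta>"
    using M_ge_1 t0_less_T \<eta> \<Gamma>_nonneg H by simp_all
  have time: "real k * H \<le> T - t0" if "k \<le> n" for k
  proof -
    have "real k * H \<le> real n * H" using that H by (intro mult_right_mono) auto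
    then show ?thesis using n by linarith
  qed
  have power: "?\<alpha> * (1 + ?\<beta>) ^ k \<le> amplification * \<eta>" if "k \<le> n" for k
  proof -
    have "(1 + ?\<beta>) ^ k \<le> exp ?\<beta> ^ k" using \<beta> by (intro power_mono) auto
    also have "\<dots> = exp (M * \<Gamma> * (real k * H))" by (simp add: exp_of_nat_mult[symmetric] mult_ac)
    also have "\<dots> \<le> exp (M * \<Gamma> * (T - t0))"
      using time[OF that] M_ge_1 \<Gamma>_nonneg by (simp add: mult_left_mono)
    finally have "?\<alpha> * (1 + ?\<beta>) ^ k \<le> ?\<alpha> * exp (M * \<Gamma> * (T - t0))" using \<alpha> by (rule mult_left_mono)
    then show ?thesis by (simp add: amplification_def mult_ac)
  qed
  have "norm (e n) \<le> ?\<alpha> * (1 + ?\<beta>) ^ n"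
  proof (rule discrete_gronwall[where a = "\<lambda>k. norm (e k)" and l = 0 and m = n, OF \<alpha> \<beta>])
    fix m assume m: "m \<le> n" and IH: "\<And>k. 0 \<le> k \<Longrightarrow> k < m \<Longrightarrow> norm (e k) \<le> ?\<alpha> * (1 + ?\<beta>) ^ k"
    define d where "d k = e (Suc k) - blinfun_apply (S H) (e k)" for k
    have d: "norm (d k) \<le> H * (\<Gamma> * norm (e k) + \<eta>)" if k: "k < m" for k
    proof -
      have T: "t0 + real (Suc k) * H \<le> T" using time[of "Suc k"] k m by simp
      let ?t = "t0 + real k * H"
      have t: "t0 \<le> ?t" "?t + H \<le> T" "t0 + real (Suc k) * H = ?t + H"
        using T H by (auto simp: algebra_simps)
      have "norm (e k) \<le> amplification * \<eta>" using IH[of k] power[of k] k m by simp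
      then have "\<kappa> * (norm (e k) + c2 * H * h ^ q) \<le> \<kappa> * (amplification * \<eta> + c2 * H * h ^ q)"
        using \<kappa>_nonneg by (intro mult_left_mono) auto
      then have small_k: "\<kappa> * (norm (w k - u ?t) + c2 * H * h ^ q) \<le> \<rho> / 2"
        using small by (simp add: e_def \<eta>_def)
      have W: "W k 1 = w k"
        "\<And>i. i \<in> {2..stages R} \<Longrightarrow>
          norm (W k i - var_const S (merk_p N R H ?t (w k) (W k) i) (w k) (node R i * H)) \<le> c2 * H * h ^ q"
        "norm (w (Suc k) - var_const S (merk_q N R H ?t (w k) (W k)) (w k) H) \<le> H * (c3 * h ^ r)"
        using run T by (auto simp: merk_run_def mult_ac)
      have "norm ((w (Suc k) - u (?t + H)) - blinfun_apply (S H) (w k - u ?t))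
          \<le> H * (\<Gamma> * norm (w k - u ?t) + (A + \<Gamma> * (c2 * H * h ^ q) + c3 * h ^ r))"
        by (rule merk_defect[OF H t(1,2) exact[OF t(1,2)] _ W(1) _ W(2,3) small_k])
          (use local[OF T, unfolded t(3)] nonneg H in auto)
      then show ?thesis unfolding d_def e_def \<eta>_def t(3) .
    qed
    have "norm (e m) \<le> M * (\<Sum>k<m. norm (d k))"
    proof (rule semigroup_recursion_bound[OF c0])
      show "e 0 = 0" using run by (simp add: e_def merk_run_def)
      show "norm (S t) \<le> M" if "0 \<le> t" "t \<le> real m * H" for t
        using that time[OF m] by (intro S_bound) auto
    qed (use H in \<open>auto simp: d_def\<close>)
    also have "\<dots> \<le> M * (\<Sum>k<m. H * (\<Gamma> * norm (e k) + \<eta>))"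
      using M_ge_1 d by (intro mult_left_mono sum_mono) auto
    also have "\<dots> = M * \<eta> * (real m * H) + ?\<beta> * (\<Sum>k<m. norm (e k))"
      by (simp add: sum.distrib sum_distrib_left[symmetric]) (simp add: algebra_simps)
    also have "M * \<eta> * (real m * H) \<le> M * \<eta> * (T - t0)"
      using M_ge_1 \<eta> time[OF m] by (intro mult_left_mono) auto
    finally show "norm (e m) \<le> ?\<alpha> + ?\<beta> * (\<Sum>k\<in>{0..<m}. norm (e k))"
      by (simp add: mult_ac atLeast0LessThan)
  qed auto
  also have "\<dots> \<le> amplification * \<eta>" by (rule power) simp
  finally show ?thesis by (simp add: e_def \<eta>_def)
qed

text \<open>
  As all orders are at least \<open>1\<close>, small \<open>H\<close> makes the error bound small enough for the previous
  lemma, whatever the solver constants. How small \<open>H\<close> must be depends on these constants; the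
  factor of \<open>H\<^sup>p\<close> in the bound does not.
\<close>

lemma merk_error_bound_small_steps:
  assumes p: "1 \<le> p" and q: "1 \<le> q" and r: "1 \<le> r" and c: "0 \<le> c2" "0 \<le> c3" and C: "0 \<le> C" and H1: "0 < H1"
    and local: "\<And>H n. 0 < H \<Longrightarrow> H \<le> H1 \<Longrightarrow> t0 + real (Suc n) * H \<le> T \<Longrightarrow>
      norm (exprk_step S N R H (t0 + real n * H) (u (t0 + real n * H)) - u (t0 + real (Suc n) * H))
        \<le> C * H ^ (p + 1)"
  obtains H0 G where "0 < H0" "0 \<le> G"
    "\<And>H h m w W n. 0 < H \<Longrightarrow> H \<le> H0 \<Longrightarrow> 1 \<le> m \<Longrightarrow> h = H / real m \<Longrightarrow>
       merk_run S N t0 T (u t0) R q r c2 c3 H h w W \<Longrightarrow> t0 + real n * H \<le> T \<Longrightarrow>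
       norm (w n - u (t0 + real n * H))
         \<le> amplification * C * H ^ p + amplification * \<Gamma> * c2 * H * h ^ q + amplification * c3 * h ^ r \<and>
       norm (w n - u (t0 + real n * H)) \<le> G * H"
proof -
  obtain H2 where H2: "0 < H2" "H2 \<le> 1" and exact: "\<And>H t i. 0 < H \<Longrightarrow> H \<le> H2 \<Longrightarrow> t0 \<le> t \<Longrightarrow> t + H \<le> T \<Longrightarrow>
      i \<in> {1..stages R} \<Longrightarrow> norm (exprk_stage S N R H t (u t) i - u (t + node R i * H)) \<le> \<rho> / 2"
    by (rule exact_stages_near_solution) (rule that)
  define G where "G = amplification * (C + \<Gamma> * c2 + c3)"
  define Q where "Q = \<kappa> * (G + c2)"
  have G: "0 \<le> G" unfolding G_def using amplification_nonneg C c \<Gamma>_nonneg by simp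
  have Q: "0 \<le> Q" unfolding Q_def using G c \<kappa>_nonneg by simp
  show ?thesis
  proof
    \<comment> \<open>The left-hand side of the smallness condition turns out to be at most \<open>Q H\<close>.\<close>
    let ?H0 = "min (min H1 H2) (\<rho> / (2 * (Q + 1)))"
    show "0 < ?H0" using H1 H2 \<rho>_pos Q by simp
    show "0 \<le> G" by (rule G)
    fix H h :: real and m :: nat and w W n
    assume H: "0 < H" "H \<le> ?H0" and m: "1 \<le> m" and h: "h = H / real m"
      and run: "merk_run S N t0 T (u t0) R q r c2 c3 H h w W" and n: "t0 + real n * H \<le> T"
    have le1: "H \<le> 1" using H H2 by simp
    have h0: "0 \<le> h" using h H by simp
    have hH: "h \<le> H" using h H m by (simp add: divide_le_eq mult_le_cancel_left1)
    have pow: "x ^ k \<le> x" if "0 \<le> x" "x \<le> 1" "1 \<le> k" for x :: real and k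
      using power_decreasing[of 1 k x] that by simp
    have Hp: "H ^ p \<le> H" and hr: "h ^ r \<le> H" and hq: "h ^ q \<le> 1"
      using pow[of H p] pow[of h r] power_le_one[of h q] p r H le1 h0 hH by auto
    have Hq: "H * h ^ q \<le> H" using mult_left_mono[OF hq, of H] H by simp
    let ?\<eta> = "C * H ^ p + \<Gamma> * (c2 * H * h ^ q) + c3 * h ^ r"
    have "?\<eta> = C * H ^ p + \<Gamma> * c2 * (H * h ^ q) + c3 * h ^ r" by simp
    also have "\<dots> \<le> C * H + \<Gamma> * c2 * H + c3 * H"
      using C c \<Gamma>_nonneg Hp Hq hr by (intro add_mono mult_left_mono) auto
    finally have "amplification * ?\<eta> \<le> amplification * (C * H + \<Gamma> * c2 * H + c3 * H)"
      by (rule mult_left_mono[OF _ amplification_nonneg])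
    also have "\<dots> = G * H" by (simp add: G_def algebra_simps)
    finally have \<eta>: "amplification * ?\<eta> \<le> G * H" .
    have "c2 * H * h ^ q \<le> c2 * H"
      using mult_left_mono[OF Hq c(1)] by (simp add: mult.assoc)
    with \<eta> have "\<kappa> * (amplification * ?\<eta> + c2 * H * h ^ q) \<le> \<kappa> * (G * H + c2 * H)"
      using \<kappa>_nonneg by (intro mult_left_mono add_mono)
    also have "\<dots> = Q * H" by (simp add: Q_def algebra_simps)
    also have "\<dots> \<le> Q * (\<rho> / (2 * (Q + 1)))" using H Q by (intro mult_left_mono) auto
    also have "\<dots> \<le> \<rho> / 2" using Q \<rho>_pos by (simp add: field_simps)
    finally have small: "\<kappa> * (amplification * ?\<eta> + c2 * H * h ^ q) \<le> \<rho> / 2" .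
    have local': "norm (exprk_step S N R H (t0 + real k * H) (u (t0 + real k * H)) - u (t0 + real (Suc k) * H))
        \<le> H * (C * H ^ p)" if "t0 + real (Suc k) * H \<le> T" for k
      using local[of H k] that H by (simp add: mult_ac)
    have "norm (w n - u (t0 + real n * H)) \<le> amplification * ?\<eta>"
      by (rule merk_error_bound[OF H(1) le1 n exact local' run _ c h0 small]) (use H C in auto)
    then show "norm (w n - u (t0 + real n * H))
         \<le> amplification * C * H ^ p + amplification * \<Gamma> * c2 * H * h ^ q + amplification * c3 * h ^ r \<and>
       norm (w n - u (t0 + real n * H)) \<le> G * H"
      using \<eta> by (simp add: algebra_simps)
  qed
qed

end

section \<open>Convergence of MERK methods\<close>

theorem theorem3p4:
  fixes S :: "real \<Rightarrow> 'a::banach \<Rightarrow>\<^sub>L 'a"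
    and D :: "'a set" and L :: "'a \<Rightarrow> 'a" and N :: "real \<Rightarrow> 'a \<Rightarrow> 'a"
    and t0 T :: real and u0 :: 'a and u :: "real \<Rightarrow> 'a"
    and K p q r :: nat and R :: exprk
  assumes "t0 < T"
    and "analytic_semigroup S" and "infinitesimal_generator D L S"
    and "solves_ivp D L N t0 T u0 u"
    and "1 \<le> K" and "smooth_curve K {t0..T} u" and "smooth_along K t0 T u N"
    and "exprk_method R" and "1 \<le> p" and "exprk_global_order S N t0 T u R p"
    and "1 \<le> q" and "1 \<le> r"
  shows "\<exists>C1. \<forall>c2\<ge>0. \<forall>c3\<ge>0.
           merk_convergent S N t0 T u R q r c2 c3 \<and>
           (\<exists>C2 C3 H0. 0 < H0 \<and>
              (\<forall>H h (m::nat) w W n.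
                 0 < H \<and> H \<le> H0 \<and> 1 \<le> m \<and> h = H / real m \<and>
                 merk_run S N t0 T u0 R q r c2 c3 H h w W \<and> t0 + real n * H \<le> T \<longrightarrow>
                 norm (w n - u (t0 + real n * H)) \<le> C1 * H ^ p + C2 * H * h ^ q + C3 * h ^ r))"
proof -
  have c0: "c0_semigroup S" using \<open>analytic_semigroup S\<close> by (simp add: analytic_semigroup_def)
  have u: "continuous_on {t0..T} u" and u0: "u0 = u t0"
    using \<open>solves_ivp D L N t0 T u0 u\<close> by (auto simp: solves_ivp_def)
  obtain M where M: "1 \<le> M" "\<And>t. 0 \<le> t \<Longrightarrow> t \<le> max 1 (T - t0) \<Longrightarrow> norm (S t) \<le> M"
    by (rule c0_semigroup_bounded[OF c0, of "max 1 (T - t0)"]) (rule that)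
  have M1: "norm (S t) \<le> M" if "0 \<le> t" "t \<le> 1" for t using M(2)[of t] that by simp
  obtain B where B: "0 \<le> B"
    "\<And>H i j x. 0 < H \<Longrightarrow> H \<le> 1 \<Longrightarrow> i \<in> {1..stages R} \<Longrightarrow> j \<in> {1..<i} \<Longrightarrow> norm (exprk_a S R H i j x) \<le> B * norm x"
    "\<And>H i x. 0 < H \<Longrightarrow> H \<le> 1 \<Longrightarrow> i \<in> {1..stages R} \<Longrightarrow> norm (exprk_b S R H i x) \<le> B * norm x"
    by (rule exprk_weights_bounded[OF c0 \<open>exprk_method R\<close> M1]) (assumption | rule that)+
  obtain \<rho> \<Lambda> where \<Lambda>: "0 < \<rho>" "0 \<le> \<Lambda>"
    "\<And>t v v'. t \<in> {t0..T} \<Longrightarrow> norm (v - u t) \<le> \<rho> \<Longrightarrow> norm (v' - u t) \<le> \<rho> \<Longrightarrow>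
       norm (N t v - N t v') \<le> \<Lambda> * norm (v - v')"
    "continuous_on {t0..T} (\<lambda>t. N t (u t))"
    by (rule smooth_along_lipschitz[OF \<open>smooth_along K t0 T u N\<close> \<open>1 \<le> K\<close> u]) (rule that)
  interpret exprk_stability S N t0 T u R M B \<Lambda> \<rho>
    by unfold_locales (use c0 assms M B \<Lambda> u in auto)
  obtain C' H1 where H1: "0 < H1" and local': "\<And>H n. 0 < H \<Longrightarrow> H \<le> H1 \<Longrightarrow> t0 + real (Suc n) * H \<le> T \<Longrightarrow>
      norm (exprk_step S N R H (t0 + real n * H) (u (t0 + real n * H)) - u (t0 + real (Suc n) * H))
        \<le> C' * H ^ (p + 1)"
    using \<open>exprk_global_order S N t0 T u R p\<close> unfolding exprk_global_order_def by (elim conjE exE) auto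
  define C where "C = \<bar>C'\<bar>"
  have C: "0 \<le> C" by (simp add: C_def)
  have local: "norm (exprk_step S N R H (t0 + real n * H) (u (t0 + real n * H)) - u (t0 + real (Suc n) * H))
        \<le> C * H ^ (p + 1)" if "0 < H" "H \<le> H1" "t0 + real (Suc n) * H \<le> T" for H n
    by (rule order_trans[OF local'[OF that]]) (use that in \<open>auto simp: C_def intro!: mult_right_mono\<close>)
  show ?thesis
  proof (intro exI[of _ "amplification * C"] allI impI)
    fix c2 c3 :: real assume c: "0 \<le> c2" "0 \<le> c3"
    obtain H0 G where H0: "0 < H0" and G: "0 \<le> G" and bound:
      "\<And>H h m w W n. 0 < H \<Longrightarrow> H \<le> H0 \<Longrightarrow> 1 \<le> m \<Longrightarrow> h = H / real m \<Longrightarrow>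
       merk_run S N t0 T (u t0) R q r c2 c3 H h w W \<Longrightarrow> t0 + real n * H \<le> T \<Longrightarrow>
       norm (w n - u (t0 + real n * H))
         \<le> amplification * C * H ^ p + amplification * \<Gamma> * c2 * H * h ^ q + amplification * c3 * h ^ r \<and>
       norm (w n - u (t0 + real n * H)) \<le> G * H"
      by (rule merk_error_bound_small_steps[OF \<open>1 \<le> p\<close> \<open>1 \<le> q\<close> \<open>1 \<le> r\<close> c C H1 local])
        (assumption | rule that)+
    have "merk_convergent S N t0 T u R q r c2 c3"
      unfolding merk_convergent_def
    proof (intro allI impI)
      fix \<epsilon> :: real assume \<epsilon>: "0 < \<epsilon>"
      show "\<exists>H0>0. \<forall>H (m::nat) w W n.
        0 < H \<and> H \<le> H0 \<and> 1 \<le> m \<and> merk_run S N t0 T (u t0) R q r c2 c3 H (H / real m) w W \<and>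
        t0 + real n * H \<le> T \<longrightarrow> norm (w n - u (t0 + real n * H)) < \<epsilon>"
      proof (intro exI[of _ "min H0 (\<epsilon> / (G + 1))"] conjI allI impI)
        show "0 < min H0 (\<epsilon> / (G + 1))" using H0 \<epsilon> G by simp
        fix H and m :: nat and w W n
        assume *: "0 < H \<and> H \<le> min H0 (\<epsilon> / (G + 1)) \<and> 1 \<le> m \<and>
          merk_run S N t0 T (u t0) R q r c2 c3 H (H / real m) w W \<and> t0 + real n * H \<le> T"
        then have "norm (w n - u (t0 + real n * H)) \<le> G * H"
          using bound[of H m "H / real m" w W n] by simp
        also have "\<dots> < (G + 1) * H" using * by (simp add: algebra_simps)
        also have "\<dots> \<le> \<epsilon>" using * G by (simp add: field_simps)
        finally show "norm (w n - u (t0 + real n * H)) < \<epsilon>" .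
      qed
    qed
    moreover have "\<exists>C2 C3 H0. 0 < H0 \<and>
              (\<forall>H h (m::nat) w W n.
                 0 < H \<and> H \<le> H0 \<and> 1 \<le> m \<and> h = H / real m \<and>
                 merk_run S N t0 T u0 R q r c2 c3 H h w W \<and> t0 + real n * H \<le> T \<longrightarrow>
                 norm (w n - u (t0 + real n * H)) \<le> amplification * C * H ^ p + C2 * H * h ^ q + C3 * h ^ r)"
      unfolding u0
      by (intro exI[of _ "amplification * \<Gamma> * c2"] exI[of _ "amplification * c3"] exI[of _ H0] conjI H0
          allI impI, elim conjE, rule bound[THEN conjunct1])
    ultimately show "merk_convergent S N t0 T u R q r c2 c3 \<and> (\<exists>C2 C3 H0. 0 < H0 \<and>
              (\<forall>H h (m::nat) w W n.
                 0 < H \<and> H \<le> H0 \<and> 1 \<le> m \<and> h = H / real m \<and>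
                 merk_run S N t0 T u0 R q r c2 c3 H h w W \<and> t0 + real n * H \<le> T \<longrightarrow>
                 norm (w n - u (t0 + real n * H)) \<le> amplification * C * H ^ p + C2 * H * h ^ q + C3 * h ^ r))"
      by (rule conjI)
  qed
qed

end
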